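(* Let $\mathcal{V}_1$ and $\mathcal{V}_2$ be non-trivial unital operator spaces (i.e. not equal to the scalar multiples of their units). Let $i:\mathcal{V}_1\otimes_h\mathcal{V}_2\to C^*_u(\mathcal{V}_1\otimes_h\mathcal{V}_2)$ be the canonical embedding. If $a\in\mathcal{V}_1$ and $b\in\mathcal{V}_2$ are non-scalar (not scalar multiples of the respective units), then $i(a\otimes b)\neq i(a\otimes I)\,i(I\otimes b)$. Hence the canonical $*$-homomorphism $\rho:C^*_u(\mathcal{V}_1\otimes_h\mathcal{V}_2)\to C^*_u(\mathcal{V}_1)*_1C^*_u(\mathcal{V}_2)$ extending the identity map on $\mathcal{V}_1\otimes_h\mathcal{V}_2$ is not a $*$-isomorphism.
   Context: An operator space $\mathcal{V}$ with a distinguished element $e$, $\|e\|=1$, is a unital operator space with unit $e$ if there is a complete isometry $\varphi:\mathcal{V}\to\mathbb{B}(\mathcal{H})$ with $\varphi(e)=I$; units are written $I$. A ucc map is a unital completely contractive linear map. A C*-cover of $\mathcal{V}$ is a C*-algebra $\mathcal{A}$ with a unital complete isometry $j:\mathcal{V}\to\mathcal{A}$ such that $\mathcal{A}=C^*(j(\mathcal{V}))$. The universal C*-cover $C^*_u(\mathcal{V})$ is the C*-cover such that every ucc map $\varphi:\mathcal{V}\to\mathbb{B}(\mathcal{H})$ extends uniquely to a $*$-homomorphism $C^*_u(\mathcal{V})\to\mathbb{B}(\mathcal{H})$. $\mathcal{A}*_1\mathcal{B}$ denotes the universal free product of unital C*-algebras amalgamated over the unit. The Haagerup tensor product $\mathcal{V}_1\otimes_h\mathcal{V}_2$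 is the algebraic tensor product with matrix norms $\|z\|_h=\inf\{\|x\|\|y\|: z=x\odot y\}$, where $x\in M_{n,k}(\mathcal{V}_1)$, $y\in M_{k,m}(\mathcal{V}_2)$, $(x\odot y)_{ij}=\sum_l x_{il}\otimes y_{lj}$; it is a unital operator space with unit $I\otimes I$. It embeds unitally completely isometrically in $C^*_u(\mathcal{V}_1)*_1C^*_u(\mathcal{V}_2)$ by $a\otimes b\mapsto a\cdot b$, and $\rho$ is the $*$-homomorphism with $\rho(i(a\otimes b))=a\cdot b$. *)

theory Defs
  imports
    Complex_Main
    "HOL-Library.FuncSet"
    "HOL-Library.Poly_Mapping"
    "Jordan_Normal_Form.Matrix"
begin

section \<open>Complex vector spaces and unital C*-algebras\<close>

class complex_vector = ab_group_add +
  fixes scaleC :: "complex \<Rightarrow> 'a \<Rightarrow> 'a" (infixr \<open>*\<^sub>C\<close> 75)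
  assumes scaleC_add_right: "c *\<^sub>C (x + y) = c *\<^sub>C x + c *\<^sub>C y"
    and scaleC_add_left: "(c + d) *\<^sub>C x = c *\<^sub>C x + d *\<^sub>C x"
    and scaleC_scaleC: "c *\<^sub>C (d *\<^sub>C x) = (c * d) *\<^sub>C x"
    and scaleC_one: "1 *\<^sub>C x = x"

global_interpretation complex_vector:
  vector_space "scaleC :: complex \<Rightarrow> 'a \<Rightarrow> 'a :: complex_vector"
  by unfold_locales (simp_all add: scaleC_add_right scaleC_add_left scaleC_scaleC scaleC_one)

abbreviation clinear :: "('a::complex_vector \<Rightarrow> 'b::complex_vector) \<Rightarrow> bool" where
  "clinear \<equiv> Vector_Spaces.linear (*\<^sub>C) (*\<^sub>C)"

class cstar_algebra = complex_vector + real_normed_algebra_1 + banach +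
  fixes adj :: "'a \<Rightarrow> 'a"
  assumes scaleR_eq_scaleC: "scaleR r x = complex_of_real r *\<^sub>C x"
    and norm_scaleC: "norm (c *\<^sub>C x) = cmod c * norm x"
    and mult_scaleC_left: "(c *\<^sub>C x) * y = c *\<^sub>C (x * y)"
    and mult_scaleC_right: "x * (c *\<^sub>C y) = c *\<^sub>C (x * y)"
    and adj_add: "adj (x + y) = adj x + adj y"
    and adj_scaleC: "adj (c *\<^sub>C x) = cnj c *\<^sub>C adj x"
    and adj_mult: "adj (x * y) = adj y * adj x"
    and adj_adj: "adj (adj x) = x"
    and cstar_identity: "norm (adj x * x) = (norm x)\<^sup>2"

definition star_hom :: "('a::cstar_algebra \<Rightarrow> 'b::cstar_algebra) \<Rightarrow> bool" where
  "star_hom \<pi> \<longleftrightarrow> clinear \<pi> \<and> (\<forall>x y. \<pi> (x * y) = \<pi> x * \<pi> y) \<and> (\<forall>x. \<pi> (adj x) = adj (\<pi> x))"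

definition star_isomorphism :: "('a::cstar_algebra \<Rightarrow> 'b::cstar_algebra) \<Rightarrow> bool" where
  "star_isomorphism \<pi> \<longleftrightarrow> star_hom \<pi> \<and> bij \<pi>"

definition cstar_subalgebra :: "'a::cstar_algebra set \<Rightarrow> bool" where
  "cstar_subalgebra S \<longleftrightarrow> complex_vector.subspace S \<and> closed S \<and>
     (\<forall>x\<in>S. \<forall>y\<in>S. x * y \<in> S) \<and> (\<forall>x\<in>S. adj x \<in> S)"

definition cstar_generated :: "'a::cstar_algebra set \<Rightarrow> 'a set" where
  "cstar_generated X = cstar_subalgebra hull X"

definition mat_adj :: "'a::cstar_algebra mat \<Rightarrow> 'a mat" where
  "mat_adj x = mat (dim_col x) (dim_row x) (\<lambda>(i, j). adj (x $$ (j, i)))"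

text \<open>A C*-norm on the *-algebra of \<open>n \<times> n\<close> matrices over a C*-algebra. There is exactly one
  such norm (up to its irrelevant values on matrices of other sizes), and it is the norm that
  makes these matrices a C*-algebra.\<close>

definition cstar_matrix_norm :: "nat \<Rightarrow> ('a::cstar_algebra mat \<Rightarrow> real) \<Rightarrow> bool" where
  "cstar_matrix_norm n N \<longleftrightarrow>
     (\<forall>x\<in>carrier_mat n n. 0 \<le> N x \<and> (N x = 0 \<longleftrightarrow> x = 0\<^sub>m n n)) \<and>
     (\<forall>x\<in>carrier_mat n n. \<forall>y\<in>carrier_mat n n. N (x + y) \<le> N x + N y) \<and>
     (\<forall>c. \<forall>x\<in>carrier_mat n n. N (map_mat (scaleC c) x) = cmod c * N x) \<and>
     (\<forall>x\<in>carrier_mat n n. \<forall>y\<in>carrier_mat n n. N (x * y) \<le> N x * N y) \<and>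
     (\<forall>x\<in>carrier_mat n n. N (mat_adj x * x) = (N x)\<^sup>2)"


section \<open>Hilbert spaces and bounded operators\<close>

text \<open>Definitions below quantify over all Hilbert spaces, so a Hilbert space is not a type but a
  linear subspace \<open>H\<close> of some ambient complex vector space, with an inner product \<open>ip\<close> (linear
  in the first argument) that is complete on \<open>H\<close>. The ambient space carries no topology.\<close>

definition hnorm :: "('h \<Rightarrow> 'h \<Rightarrow> complex) \<Rightarrow> 'h \<Rightarrow> real" where
  "hnorm ip \<xi> = sqrt (Re (ip \<xi> \<xi>))"

definition hilbert_space :: "'h::complex_vector set \<Rightarrow> ('h \<Rightarrow> 'h \<Rightarrow> complex) \<Rightarrow> bool" where
  "hilbert_space H ip \<longleftrightarrow>
     complex_vector.subspace H \<and>
     (\<forall>\<xi>\<in>H. \<forall>\<eta>\<in>H. \<forall>\<zeta>\<in>H. ip (\<xi> + \<eta>) \<zeta> = ip \<xi> \<zeta> + ip \<eta> \<zeta>) \<and>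
     (\<forall>c. \<forall>\<xi>\<in>H. \<forall>\<eta>\<in>H. ip (c *\<^sub>C \<xi>) \<eta> = c * ip \<xi> \<eta>) \<and>
     (\<forall>\<xi>\<in>H. \<forall>\<eta>\<in>H. ip \<eta> \<xi> = cnj (ip \<xi> \<eta>)) \<and>
     (\<forall>\<xi>\<in>H. 0 \<le> Re (ip \<xi> \<xi>) \<and> (ip \<xi> \<xi> = 0 \<longrightarrow> \<xi> = 0)) \<and>
     (\<forall>X :: nat \<Rightarrow> 'h. (\<forall>n. X n \<in> H) \<and>
        (\<forall>\<epsilon>>0. \<exists>M. \<forall>m\<ge>M. \<forall>n\<ge>M. hnorm ip (X m - X n) < \<epsilon>) \<longrightarrow>
        (\<exists>\<xi>\<in>H. (\<lambda>n. hnorm ip (X n - \<xi>)) \<longlonglongrightarrow> 0))"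

text \<open>Operators are undefined outside \<open>H\<close>, so that equality of operators is equality on \<open>H\<close>.\<close>

definition bounded_operators ::
    "'h::complex_vector set \<Rightarrow> ('h \<Rightarrow> 'h \<Rightarrow> complex) \<Rightarrow> ('h \<Rightarrow> 'h) set" where
  "bounded_operators H ip = {T \<in> H \<rightarrow>\<^sub>E H.
     (\<forall>\<xi>\<in>H. \<forall>\<eta>\<in>H. T (\<xi> + \<eta>) = T \<xi> + T \<eta>) \<and>
     (\<forall>c. \<forall>\<xi>\<in>H. T (c *\<^sub>C \<xi>) = c *\<^sub>C T \<xi>) \<and>
     (\<exists>K. \<forall>\<xi>\<in>H. hnorm ip (T \<xi>) \<le> K * hnorm ip \<xi>)}"

abbreviation id_operator :: "'h set \<Rightarrow> 'h \<Rightarrow> 'h" where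
  "id_operator H \<equiv> (\<lambda>\<xi>\<in>H. \<xi>)"

text \<open>The norm of an \<open>n \<times> m\<close> matrix of operators on \<open>H\<close>, as an operator from the Hilbert sum of
  \<open>m\<close> copies of \<open>H\<close> to the Hilbert sum of \<open>n\<close> copies.\<close>

definition operator_matrix_norm ::
    "'h::complex_vector set \<Rightarrow> ('h \<Rightarrow> 'h \<Rightarrow> complex) \<Rightarrow> ('h \<Rightarrow> 'h) mat \<Rightarrow> real" where
  "operator_matrix_norm H ip T =
     Sup {sqrt (\<Sum>i<dim_row T. (hnorm ip (\<Sum>j<dim_col T. (T $$ (i, j)) (\<xi> j)))\<^sup>2) | \<xi>.
          (\<forall>j<dim_col T. \<xi> j \<in> H) \<and> (\<Sum>j<dim_col T. (hnorm ip (\<xi> j))\<^sup>2) \<le> 1}"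

definition operator_linear ::
    "'h::complex_vector set \<Rightarrow> ('h \<Rightarrow> 'h \<Rightarrow> complex) \<Rightarrow> ('v::complex_vector \<Rightarrow> 'h \<Rightarrow> 'h) \<Rightarrow> bool"
  where
  "operator_linear H ip \<phi> \<longleftrightarrow>
     (\<forall>x. \<phi> x \<in> bounded_operators H ip) \<and>
     (\<forall>x y. \<forall>\<xi>\<in>H. \<phi> (x + y) \<xi> = \<phi> x \<xi> + \<phi> y \<xi>) \<and>
     (\<forall>c x. \<forall>\<xi>\<in>H. \<phi> (c *\<^sub>C x) \<xi> = c *\<^sub>C \<phi> x \<xi>)"

text \<open>*-homomorphisms from a C*-algebra to the bounded operators on \<open>H\<close>.\<close>

definition star_rep ::
    "'h::complex_vector set \<Rightarrow> ('h \<Rightarrow> 'h \<Rightarrow> complex) \<Rightarrow> ('a::cstar_algebra \<Rightarrow> 'h \<Rightarrow> 'h) \<Rightarrow> bool"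
  where
  "star_rep H ip \<pi> \<longleftrightarrow>
     operator_linear H ip \<pi> \<and>
     (\<forall>x y. \<forall>\<xi>\<in>H. \<pi> (x * y) \<xi> = \<pi> x (\<pi> y \<xi>)) \<and>
     (\<forall>x. \<forall>\<xi>\<in>H. \<forall>\<eta>\<in>H. ip (\<pi> (adj x) \<xi>) \<eta> = ip \<xi> (\<pi> x \<eta>))"


section \<open>Unital operator spaces\<close>

text \<open>An operator space is a type \<open>'v\<close> with a function \<open>nrm\<close> that gives the norms of all
  matrices over \<open>'v\<close>, including rectangular ones (these are needed for the Haagerup tensor
  product; their norms are those of the square matrices obtained by adding zero rows or
  columns). The type \<open>'h\<close> is the ambient space of the Hilbert space on which it is
  represented. Ruan's axioms hold because of the complete isometry.\<close>

definition unital_operator_space ::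
    "'h::complex_vector itself \<Rightarrow> ('v::complex_vector mat \<Rightarrow> real) \<Rightarrow> 'v \<Rightarrow> bool" where
  "unital_operator_space _ nrm e \<longleftrightarrow>
     nrm (mat 1 1 (\<lambda>_. e)) = 1 \<and>
     (\<exists>(H :: 'h set) ip \<phi>. hilbert_space H ip \<and> operator_linear H ip \<phi> \<and> inj \<phi> \<and>
        (\<forall>x. operator_matrix_norm H ip (map_mat \<phi> x) = nrm x) \<and>
        \<phi> e = id_operator H)"

definition scalars :: "'v::complex_vector \<Rightarrow> 'v set" where
  "scalars e = range (\<lambda>c. c *\<^sub>C e)"

text \<open>Unital completely contractive maps to the bounded operators on \<open>H\<close>.\<close>

definition ucc ::
    "('v::complex_vector mat \<Rightarrow> real) \<Rightarrow> 'v \<Rightarrow>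
     'h::complex_vector set \<Rightarrow> ('h \<Rightarrow> 'h \<Rightarrow> complex) \<Rightarrow> ('v \<Rightarrow> 'h \<Rightarrow> 'h) \<Rightarrow> bool" where
  "ucc nrm e H ip \<phi> \<longleftrightarrow>
     operator_linear H ip \<phi> \<and> \<phi> e = id_operator H \<and>
     (\<forall>n. \<forall>x\<in>carrier_mat n n. operator_matrix_norm H ip (map_mat \<phi> x) \<le> nrm x)"

definition cstar_cover ::
    "('v::complex_vector mat \<Rightarrow> real) \<Rightarrow> 'v \<Rightarrow> ('v \<Rightarrow> 'a::cstar_algebra) \<Rightarrow> bool" where
  "cstar_cover nrm e j \<longleftrightarrow>
     clinear j \<and> j e = 1 \<and>
     (\<forall>n. \<exists>N. cstar_matrix_norm n N \<and> (\<forall>x\<in>carrier_mat n n. N (map_mat j x) = nrm x)) \<and>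
     cstar_generated (range j) = UNIV"

text \<open>Universal properties refer to all Hilbert spaces, but a formula can quantify only over those
  inside a given ambient space \<open>'h\<close>. The next condition says that \<open>'h\<close> is large enough for this
  to make no difference for structures generated by a copy of \<open>'v\<close>: every Hilbert space with a
  dense subset of cardinality at most that of \<open>'v\<close> has at most as many elements as the type
  \<open>'v \<Rightarrow> complex\<close>, so it is isomorphic to one inside \<open>'h\<close>, and every representation of such a
  structure is a direct sum of representations on spaces of this size.\<close>

definition ample :: "'h::complex_vector itself \<Rightarrow> 'v itself \<Rightarrow> bool" where
  "ample _ _ \<longleftrightarrow> (\<exists>f :: ('v \<Rightarrow> complex) \<Rightarrow> 'h. inj f \<and> complex_vector.independent (range f))"

definition universal_cstar_cover ::
    "'h::complex_vector itself \<Rightarrow> ('v::complex_vector mat \<Rightarrow> real) \<Rightarrow> 'v \<Rightarrow>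
     ('v \<Rightarrow> 'a::cstar_algebra) \<Rightarrow> bool" where
  "universal_cstar_cover _ nrm e j \<longleftrightarrow>
     cstar_cover nrm e j \<and>
     (\<forall>(H :: 'h set) ip \<phi>. hilbert_space H ip \<and> ucc nrm e H ip \<phi> \<longrightarrow>
        (\<exists>!\<pi>. star_rep H ip \<pi> \<and> (\<forall>v. \<pi> (j v) = \<phi> v)))"

text \<open>The free product amalgamated over the unit, with its universal property stated for unital
  representations on Hilbert spaces; since every C*-algebra has a faithful one, this is the
  universal property for unital *-homomorphisms to arbitrary unital C*-algebras.\<close>

definition unital_free_product ::
    "'h::complex_vector itself \<Rightarrow> ('a::cstar_algebra \<Rightarrow> 'f::cstar_algebra) \<Rightarrow>
     ('b::cstar_algebra \<Rightarrow> 'f) \<Rightarrow> bool" where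
  "unital_free_product _ \<iota>\<^sub>1 \<iota>\<^sub>2 \<longleftrightarrow>
     star_hom \<iota>\<^sub>1 \<and> \<iota>\<^sub>1 1 = 1 \<and> star_hom \<iota>\<^sub>2 \<and> \<iota>\<^sub>2 1 = 1 \<and>
     cstar_generated (range \<iota>\<^sub>1 \<union> range \<iota>\<^sub>2) = UNIV \<and>
     (\<forall>(H :: 'h set) ip \<pi>\<^sub>1 \<pi>\<^sub>2. hilbert_space H ip \<and>
        star_rep H ip \<pi>\<^sub>1 \<and> \<pi>\<^sub>1 1 = id_operator H \<and> star_rep H ip \<pi>\<^sub>2 \<and> \<pi>\<^sub>2 1 = id_operator H \<longrightarrow>
        (\<exists>!\<pi>. star_rep H ip \<pi> \<and> (\<forall>x. \<pi> (\<iota>\<^sub>1 x) = \<pi>\<^sub>1 x) \<and> (\<forall>y. \<pi> (\<iota>\<^sub>2 y) = \<pi>\<^sub>2 y)))"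


section \<open>The Haagerup tensor product\<close>

text \<open>The algebraic tensor product is the quotient of the free complex vector space on
  \<open>'v \<times> 'w\<close> by the bilinearity relations.\<close>

instantiation poly_mapping :: (type, complex_vector) complex_vector
begin

lift_definition scaleC_poly_mapping :: "complex \<Rightarrow> ('a \<Rightarrow>\<^sub>0 'b) \<Rightarrow> 'a \<Rightarrow>\<^sub>0 'b"
  is "\<lambda>c f x. c *\<^sub>C f x"
  by (erule rev_finite_subset) (auto simp: complex_vector.scale_zero_right)

instance
  by standard (transfer, simp add: fun_eq_iff complex_vector.scale_right_distrib
      complex_vector.scale_left_distrib)+

end

instantiation complex :: complex_vector
begin

definition scaleC_complex :: "complex \<Rightarrow> complex \<Rightarrow> complex" where
  "scaleC_complex c z = c * z"

instance
  by standard (simp_all add: scaleC_complex_def algebra_simps)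

end

abbreviation free_tensor :: "'v \<Rightarrow> 'w \<Rightarrow> ('v \<times> 'w) \<Rightarrow>\<^sub>0 complex" where
  "free_tensor x y \<equiv> Poly_Mapping.single (x, y) 1"

definition bilinearity_relations ::
    "(('v::complex_vector \<times> 'w::complex_vector) \<Rightarrow>\<^sub>0 complex) set" where
  "bilinearity_relations =
     {free_tensor (x + x') y - free_tensor x y - free_tensor x' y | x x' y. True} \<union>
     {free_tensor x (y + y') - free_tensor x y - free_tensor x y' | x y y'. True} \<union>
     {free_tensor (c *\<^sub>C x) y - c *\<^sub>C free_tensor x y | c x y. True} \<union>
     {free_tensor x (c *\<^sub>C y) - c *\<^sub>C free_tensor x y | c x y. True}"

definition tensor_rel ::
    "(('v::complex_vector \<times> 'w::complex_vector) \<Rightarrow>\<^sub>0 complex) \<Rightarrow> (('v \<times> 'w) \<Rightarrow>\<^sub>0 complex) \<Rightarrow> bool"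
  where
  "tensor_rel p q \<longleftrightarrow> p - q \<in> complex_vector.span bilinearity_relations"

quotient_type (overloaded) ('v, 'w) tensor =
    "('v::complex_vector \<times> 'w::complex_vector) \<Rightarrow>\<^sub>0 complex" / tensor_rel
proof (rule equivpI)
  show "reflp (tensor_rel :: (('v \<times> 'w) \<Rightarrow>\<^sub>0 complex) \<Rightarrow> _)"
    by (simp add: reflp_def tensor_rel_def complex_vector.span_zero)
  show "symp (tensor_rel :: (('v \<times> 'w) \<Rightarrow>\<^sub>0 complex) \<Rightarrow> _)"
    unfolding symp_def tensor_rel_def
    by (metis complex_vector.span_neg minus_diff_eq)
  show "transp (tensor_rel :: (('v \<times> 'w) \<Rightarrow>\<^sub>0 complex) \<Rightarrow> _)"
    unfolding transp_def tensor_rel_def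
    using complex_vector.span_add by fastforce
qed

instantiation tensor :: (complex_vector, complex_vector) complex_vector
begin

lift_definition zero_tensor :: "('a, 'b) tensor" is 0 .

lift_definition plus_tensor :: "('a, 'b) tensor \<Rightarrow> ('a, 'b) tensor \<Rightarrow> ('a, 'b) tensor" is "(+)"
  unfolding tensor_rel_def by (metis add_diff_add complex_vector.span_add)

lift_definition minus_tensor :: "('a, 'b) tensor \<Rightarrow> ('a, 'b) tensor \<Rightarrow> ('a, 'b) tensor" is "(-)"
  unfolding tensor_rel_def
proof -
  fix p q p' q' :: "('a \<times> 'b) \<Rightarrow>\<^sub>0 complex"
  assume "p - q \<in> complex_vector.span bilinearity_relations"
    and "p' - q' \<in> complex_vector.span bilinearity_relations"
  then have "(p - q) - (p' - q') \<in> complex_vector.span bilinearity_relations"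
    by (rule complex_vector.span_diff)
  then show "(p - p') - (q - q') \<in> complex_vector.span bilinearity_relations"
    by (simp only: diff_diff_eq diff_diff_eq2 add_diff_eq diff_add_eq ac_simps)
qed

lift_definition uminus_tensor :: "('a, 'b) tensor \<Rightarrow> ('a, 'b) tensor" is uminus
  unfolding tensor_rel_def
  by (metis complex_vector.span_neg minus_diff_minus)

lift_definition scaleC_tensor :: "complex \<Rightarrow> ('a, 'b) tensor \<Rightarrow> ('a, 'b) tensor" is scaleC
  unfolding tensor_rel_def
  by (metis complex_vector.span_scale complex_vector.scale_right_diff_distrib)

instance
  by standard (transfer, simp add: tensor_rel_def complex_vector.span_zero
      complex_vector.scale_right_distrib complex_vector.scale_left_distrib algebra_simps)+

end

lift_definition tensor :: "'v::complex_vector \<Rightarrow> 'w::complex_vector \<Rightarrow> ('v, 'w) tensor"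
    (infixl \<open>\<otimes>\<^sub>C\<close> 70)
  is free_tensor .

definition matrix_tensor ::
    "'v::complex_vector mat \<Rightarrow> 'w::complex_vector mat \<Rightarrow> ('v, 'w) tensor mat" (infixl \<open>\<odot>\<close> 70)
  where
  "x \<odot> y = mat (dim_row x) (dim_col y)
     (\<lambda>(i, j). \<Sum>l<dim_col x. x $$ (i, l) \<otimes>\<^sub>C y $$ (l, j))"

definition haagerup_norm ::
    "('v::complex_vector mat \<Rightarrow> real) \<Rightarrow> ('w::complex_vector mat \<Rightarrow> real) \<Rightarrow>
     ('v, 'w) tensor mat \<Rightarrow> real" where
  "haagerup_norm nrm\<^sub>1 nrm\<^sub>2 z =
     Inf {nrm\<^sub>1 x * nrm\<^sub>2 y | x y k.
          x \<in> carrier_mat (dim_row z) k \<and> y \<in> carrier_mat k (dim_col z) \<and> z = x \<odot> y}"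

end

(*
  It suffices to find a unital contractive functional on the Haagerup tensor product (that is, a ucc
  map into B(C)) that does not satisfy psi(a * b) = psi(a * 1) psi(1 * b), since the representation
  of the universal C*-cover extending it separates i(a * b) from i(a * 1) i(1 * b). A non-scalar
  operator has a nonzero off-diagonal entry for some orthonormal pair, so choose orthonormal p, q
  with <a q, p> nonzero and orthonormal p', q' with <b p', q'> nonzero, and let
    psi(x * y) = <x p, p> <y p', p'> + <x q, p> <y p', q'>,
  a contractive row times a contractive column. The second summand vanishes when x or y is the unit,
  but not for x = a and y = b.
*)

theory Submission
  imports Defs
begin

section \<open>Tensors\<close>

text \<open>Compression of operators to the plane spanned by an orthonormal pair is a ucc map into
  the 2 by 2 matrices. With both planes identified with C^2, the Haagerup norm is made for the
  product of two such compressions, x * y mapped to Phi_1(x) Phi_2(y), to be ucc again; psi is the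
  upper left entry of this product. It fails to be multiplicative by exactly the product of an
  off-diagonal entry of a and one of b. Contractivity is proved for matrices of every size at once,
  because the row and column estimates are the same for all sizes. The obstacles are of a concrete
  kind: a functional on the quotient defining the tensor product has to be lifted from a bilinear
  form, the norms are real suprema and infima, so that boundedness or nonemptiness of their index
  sets must be established, and B(C) must be realized on a line inside the ambient space. The
  statement on rho follows because rho maps both i(a * b) and i(a * 1) i(1 * b) to the product of a
  and b.\<close>

lemma free_tensor_decomposition:
  fixes p :: "('v \<times> 'w) \<Rightarrow>\<^sub>0 complex"
  shows "p = (\<Sum>(x, y)\<in>Poly_Mapping.keys p. Poly_Mapping.lookup p (x, y) *\<^sub>C free_tensor x y)"
proof (rule poly_mapping_eqI)
  fix k
  have "Poly_Mapping.lookup (\<Sum>(x, y)\<in>Poly_Mapping.keys p.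
      Poly_Mapping.lookup p (x, y) *\<^sub>C free_tensor x y) k
    = (\<Sum>s\<in>Poly_Mapping.keys p. if s = k then Poly_Mapping.lookup p s else 0)"
    by (simp add: lookup_sum case_prod_unfold scaleC_poly_mapping.rep_eq scaleC_complex_def
        lookup_single when_def if_distrib cong: if_cong)
  also have "\<dots> = Poly_Mapping.lookup p k"
    by (simp add: in_keys_iff)
  finally show "Poly_Mapping.lookup p k = Poly_Mapping.lookup (\<Sum>(x, y)\<in>Poly_Mapping.keys p.
      Poly_Mapping.lookup p (x, y) *\<^sub>C free_tensor x y) k" by simp
qed

lemma tensor_add_left: "(x + x') \<otimes>\<^sub>C y = x \<otimes>\<^sub>C y + x' \<otimes>\<^sub>C y"
  by (transfer, unfold tensor_rel_def diff_diff_eq[symmetric], rule complex_vector.span_base,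
      unfold bilinearity_relations_def, blast)

lemma tensor_add_right: "x \<otimes>\<^sub>C (y + y') = x \<otimes>\<^sub>C y + x \<otimes>\<^sub>C y'"
  by (transfer, unfold tensor_rel_def diff_diff_eq[symmetric], rule complex_vector.span_base,
      unfold bilinearity_relations_def, blast)

lemma tensor_scaleC_left: "(c *\<^sub>C x) \<otimes>\<^sub>C y = c *\<^sub>C (x \<otimes>\<^sub>C y)"
  by (transfer, unfold tensor_rel_def, rule complex_vector.span_base,
      auto simp: bilinearity_relations_def)

lemma tensor_zero_left [simp]: "0 \<otimes>\<^sub>C y = 0"
  using tensor_add_left[of 0 0 y] by simp

lemma tensor_zero_right [simp]: "x \<otimes>\<^sub>C 0 = 0"
  using tensor_add_right[of x 0 0] by simp

text \<open>A coefficient can be absorbed into the left factor, so every tensor is a plain finite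
  sum of elementary ones; hence there is no case for scalar multiples.\<close>

lemma tensor_induct [case_names zero elementary add]:
  fixes t :: "('v::complex_vector, 'w::complex_vector) tensor"
  assumes zero: "P 0" and elementary: "\<And>x y. P (x \<otimes>\<^sub>C y)" and add: "\<And>s t. P s \<Longrightarrow> P t \<Longrightarrow> P (s + t)"
  shows "P t"
proof -
  have abs_add: "abs_tensor (p + q) = abs_tensor p + abs_tensor q"
    and abs_scale: "abs_tensor (c *\<^sub>C p) = c *\<^sub>C abs_tensor p"
    for p q :: "('v \<times> 'w) \<Rightarrow>\<^sub>0 complex" and c
    by (simp_all add: plus_tensor.abs_eq scaleC_tensor.abs_eq)
  have sum: "P (abs_tensor (\<Sum>(x, y)\<in>S. f (x, y) *\<^sub>C free_tensor x y))"
    if "finite S" for S and f :: "'v \<times> 'w \<Rightarrow> complex"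
    using that
  proof induction
    case empty
    show ?case using zero by (simp add: zero_tensor_def)
  next
    case (insert s S)
    obtain x y where s: "s = (x, y)" by force
    have "abs_tensor (f s *\<^sub>C free_tensor x y) = (f s *\<^sub>C x) \<otimes>\<^sub>C y"
      by (simp only: abs_scale tensor_scaleC_left, simp only: tensor.abs_eq)
    then have "P (abs_tensor (f s *\<^sub>C free_tensor x y))"
      by (simp only: elementary)
    then show ?case
      using insert add by (simp add: abs_add s)
  qed
  have "P (abs_tensor (rep_tensor t))"
    using sum[of "Poly_Mapping.keys (rep_tensor t)" "Poly_Mapping.lookup (rep_tensor t)"]
    unfolding free_tensor_decomposition[of "rep_tensor t", symmetric] by simp
  then show ?thesis by (simp add: Quotient3_abs_rep[OF Quotient3_tensor])
qed

text \<open>Universal property of the algebraic tensor product for complex-valued forms: the linear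
  extension \<open>L\<close> of \<open>B\<close> to the free space kills each kind of bilinearity
  relation, hence their span, and descends to the quotient.\<close>

lemma bilinear_lift:
  fixes B :: "'v::complex_vector \<Rightarrow> 'w::complex_vector \<Rightarrow> complex"
  assumes "\<And>x x' y. B (x + x') y = B x y + B x' y" and "\<And>x y y'. B x (y + y') = B x y + B x y'"
    and "\<And>c x y. B (c *\<^sub>C x) y = c * B x y" and "\<And>c x y. B x (c *\<^sub>C y) = c * B x y"
  obtains \<psi> :: "('v, 'w) tensor \<Rightarrow> complex"
  where "\<And>s t. \<psi> (s + t) = \<psi> s + \<psi> t" and "\<And>c t. \<psi> (c *\<^sub>C t) = c * \<psi> t"
    and "\<And>x y. \<psi> (x \<otimes>\<^sub>C y) = B x y"
proof -
  define L :: "(('v \<times> 'w) \<Rightarrow>\<^sub>0 complex) \<Rightarrow> complex"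
    where "L p = (\<Sum>k\<in>Poly_Mapping.keys p. Poly_Mapping.lookup p k * case_prod B k)" for p
  \<comment> \<open>Allowing zero coefficients lets sums over different supports be compared over a
    common finite set.\<close>
  have L_superset: "L p = (\<Sum>k\<in>S. Poly_Mapping.lookup p k * case_prod B k)"
    if "finite S" "Poly_Mapping.keys p \<subseteq> S" for S p
    unfolding L_def using that by (intro sum.mono_neutral_left) (auto simp: in_keys_iff)
  have L_add: "L (p + q) = L p + L q" for p q
    by (subst (1 2 3) L_superset[of "Poly_Mapping.keys p \<union> Poly_Mapping.keys q"])
      (auto simp: lookup_add sum.distrib algebra_simps dest: subsetD[OF keys_add])
  have L_scale: "L (c *\<^sub>C p) = c * L p" for c p
    by (subst (1 2) L_superset[of "Poly_Mapping.keys p"])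
      (auto simp: in_keys_iff scaleC_poly_mapping.rep_eq scaleC_complex_def sum_distrib_left
        algebra_simps)
  have L_diff: "L (p - q) = L p - L q" for p q
    using L_add[of "p - q" q] by simp
  have L_single: "L (free_tensor x y) = B x y" for x y
    by (simp add: L_def)
  have L_zero: "L p = 0" if "p \<in> complex_vector.span bilinearity_relations" for p
    using that
  proof (induction rule: complex_vector.span_induct_alt)
    case base
    show ?case by (simp add: L_def)
  next
    case (step c x y)
    then have "L x = 0"
      by (auto simp: bilinearity_relations_def L_diff L_scale L_single assms)
    with step show ?case by (simp add: L_add L_scale)
  qed
  define \<psi> where "\<psi> t = L (rep_tensor t)" for t
  \<comment> \<open>\<open>\<psi>\<close> was defined through a chosen representative; this shows
    that the choice does not matter.\<close>
  have psi_abs: "\<psi> (abs_tensor p) = L p" for p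
  proof -
    have "tensor_rel (rep_tensor (abs_tensor p)) p"
      by (rule Quotient3_rep_abs[OF Quotient3_tensor])
        (simp add: tensor_rel_def complex_vector.span_zero)
    then show ?thesis
      using L_zero[of "rep_tensor (abs_tensor p) - p"] by (simp add: tensor_rel_def \<psi>_def L_diff)
  qed
  have abs_rep: "t = abs_tensor (rep_tensor t)" for t :: "('v, 'w) tensor"
    by (simp add: Quotient3_abs_rep[OF Quotient3_tensor])
  show ?thesis
  proof
    show "\<psi> (s + t) = \<psi> s + \<psi> t" for s t
      by (subst (1 2) abs_rep) (simp only: plus_tensor.abs_eq psi_abs L_add, simp add: \<psi>_def)
    show "\<psi> (c *\<^sub>C t) = c * \<psi> t" for c t
      by (subst (1) abs_rep) (simp only: scaleC_tensor.abs_eq psi_abs L_scale, simp add: \<psi>_def)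
    show "\<psi> (x \<otimes>\<^sub>C y) = B x y" for x y
      by (simp add: tensor.abs_eq psi_abs L_single)
  qed
qed

text \<open>Ensures that the infimum defining the Haagerup norm is taken over a nonempty set.\<close>

lemma matrix_tensor_factorization:
  fixes z :: "('v::complex_vector, 'w::complex_vector) tensor mat"
  obtains k x y where "x \<in> carrier_mat (dim_row z) k" and "y \<in> carrier_mat k (dim_col z)"
    and "z = x \<odot> y"
proof -
  \<comment> \<open>\<open>D\<close> collects functions on all pairs of indices that factor with
    finite inner dimension. Leaving out the outer dimensions makes sums free of side
    conditions.\<close>
  define D :: "(nat \<Rightarrow> nat \<Rightarrow> ('v, 'w) tensor) set"
    where "D = {f. \<exists>k g h. \<forall>i j. f i j = (\<Sum>l<(k::nat). g i l \<otimes>\<^sub>C h l j)}"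
  have D_zero: "(\<lambda>i j. 0) \<in> D"
    unfolding D_def by (auto intro!: exI[of _ 0])
  have D_add: "(\<lambda>i j. f i j + f' i j) \<in> D" if "f \<in> D" "f' \<in> D" for f f'
  proof -
    from that obtain k g h k' g' h' where
      f: "\<And>i j. f i j = (\<Sum>l<(k::nat). g i l \<otimes>\<^sub>C h l j)" and
      f': "\<And>i j. f' i j = (\<Sum>l<(k'::nat). g' i l \<otimes>\<^sub>C h' l j)"
      unfolding D_def by auto
    have split: "(\<Sum>l<k + k'. F l) = (\<Sum>l<k. F l) + (\<Sum>l<k'. F (k + l))"
      for F :: "nat \<Rightarrow> ('v, 'w) tensor"
      by (induction k') (simp_all add: add.assoc)
    \<comment> \<open>Block factorization: the columns of \<open>g\<close> are followed by those of
      \<open>g'\<close>, and the rows of \<open>h\<close> by those of \<open>h'\<close>.\<close>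
    have eq: "f i j + f' i j = (\<Sum>l<k + k'. (if l < k then g i l else g' i (l - k)) \<otimes>\<^sub>C
        (if l < k then h l j else h' (l - k) j))" for i j
      unfolding f f' split by simp
    show ?thesis unfolding D_def by (intro CollectI exI allI) (rule eq)
  qed
  have D_single: "(\<lambda>i j. if i = i0 \<and> j = j0 then t else 0) \<in> D" for i0 j0 t
  proof (induction t rule: tensor_induct)
    case zero
    show ?case using D_zero by simp
  next
    case (elementary x y)
    \<comment> \<open>A column with single entry \<open>x\<close> times a row with single entry
      \<open>y\<close>, so the inner dimension is 1.\<close>
    have eq: "(if i = i0 \<and> j = j0 then x \<otimes>\<^sub>C y else 0) =
      (\<Sum>l<1::nat. (if i = i0 then x else 0) \<otimes>\<^sub>C (if j = j0 then y else 0))" for i j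
      by simp
    show ?case unfolding D_def by (intro CollectI exI allI) (rule eq)
  next
    case (add s t)
    from D_add[OF this] show ?case
      by (rule back_subst[of "\<lambda>f. f \<in> D"]) (auto simp: fun_eq_iff)
  qed
  have D_sum: "(\<lambda>i j. \<Sum>s\<in>S. F s i j) \<in> D"
    if "finite S" "\<And>s. s \<in> S \<Longrightarrow> F s \<in> D" for F and S :: "(nat \<times> nat) set"
    using that by (induction S) (auto intro: D_zero D_add)
  define S where "S = {..<dim_row z} \<times> {..<dim_col z}"
  \<comment> \<open>\<open>z\<close> is the sum of its single-entry matrices.\<close>
  have "(\<lambda>i j. \<Sum>s\<in>S. if i = fst s \<and> j = snd s then z $$ s else 0) \<in> D"
    using D_single by (intro D_sum) (auto simp: S_def)
  then obtain k g h where
    kgh: "\<And>i j. (\<Sum>s\<in>S. if i = fst s \<and> j = snd s then z $$ s else 0) =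
      (\<Sum>l<(k::nat). g i l \<otimes>\<^sub>C h l j)"
    unfolding D_def by auto
  have entry: "(\<Sum>s\<in>S. if i = fst s \<and> j = snd s then z $$ s else 0) = z $$ (i, j)"
    if "i < dim_row z" "j < dim_col z" for i j
  proof -
    have "(\<Sum>s\<in>S. if i = fst s \<and> j = snd s then z $$ s else 0)
      = (\<Sum>s\<in>S. if s = (i, j) then z $$ s else 0)"
      by (intro sum.cong) (auto simp: prod_eq_iff)
    then show ?thesis using that by (simp add: S_def)
  qed
  show ?thesis
  proof
    show "mat (dim_row z) k (case_prod g) \<in> carrier_mat (dim_row z) k"
      and "mat k (dim_col z) (case_prod h) \<in> carrier_mat k (dim_col z)" by simp_all
    show "z = mat (dim_row z) k (case_prod g) \<odot> mat k (dim_col z) (case_prod h)"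
      by (rule eq_matI) (simp_all add: matrix_tensor_def kgh[symmetric] entry)
  qed
qed


section \<open>Operators on a Hilbert space\<close>

locale hilbert =
  fixes H :: "'h::complex_vector set" and ip :: "'h \<Rightarrow> 'h \<Rightarrow> complex"
  assumes hilbert_space: "hilbert_space H ip"
begin

lemma subspace: "complex_vector.subspace H"
  using hilbert_space unfolding hilbert_space_def by blast

lemmas closed = complex_vector.subspace_0[OF subspace] complex_vector.subspace_add[OF subspace]
  complex_vector.subspace_scale[OF subspace] complex_vector.subspace_diff[OF subspace]

lemma sum_closed: "(\<And>i. i \<in> I \<Longrightarrow> f i \<in> H) \<Longrightarrow> sum f I \<in> H"
  by (rule complex_vector.subspace_sum[OF subspace])

lemma ip_add_left: "\<xi> \<in> H \<Longrightarrow> \<eta> \<in> H \<Longrightarrow> \<zeta> \<in> H \<Longrightarrow> ip (\<xi> + \<eta>) \<zeta> = ip \<xi> \<zeta> + ip \<eta> \<zeta>"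
  and ip_scale_left: "\<xi> \<in> H \<Longrightarrow> \<eta> \<in> H \<Longrightarrow> ip (c *\<^sub>C \<xi>) \<eta> = c * ip \<xi> \<eta>"
  and ip_commute: "\<xi> \<in> H \<Longrightarrow> \<eta> \<in> H \<Longrightarrow> ip \<eta> \<xi> = cnj (ip \<xi> \<eta>)"
  and ip_nonneg: "\<xi> \<in> H \<Longrightarrow> 0 \<le> Re (ip \<xi> \<xi>)"
  and ip_definite: "\<xi> \<in> H \<Longrightarrow> ip \<xi> \<xi> = 0 \<Longrightarrow> \<xi> = 0"
  using hilbert_space unfolding hilbert_space_def by blast+

lemma ip_diff_left: "\<xi> \<in> H \<Longrightarrow> \<eta> \<in> H \<Longrightarrow> \<zeta> \<in> H \<Longrightarrow> ip (\<xi> - \<eta>) \<zeta> = ip \<xi> \<zeta> - ip \<eta> \<zeta>"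
  using ip_add_left[of "\<xi> - \<eta>" \<eta> \<zeta>] closed by simp

lemma ip_add_right: "\<xi> \<in> H \<Longrightarrow> \<eta> \<in> H \<Longrightarrow> \<zeta> \<in> H \<Longrightarrow> ip \<zeta> (\<xi> + \<eta>) = ip \<zeta> \<xi> + ip \<zeta> \<eta>"
  by (metis closed(2) complex_cnj_add ip_add_left ip_commute)

lemma ip_diff_right: "\<xi> \<in> H \<Longrightarrow> \<eta> \<in> H \<Longrightarrow> \<zeta> \<in> H \<Longrightarrow> ip \<zeta> (\<xi> - \<eta>) = ip \<zeta> \<xi> - ip \<zeta> \<eta>"
  by (metis closed(4) complex_cnj_diff ip_diff_left ip_commute)

lemma ip_scale_right: "\<xi> \<in> H \<Longrightarrow> \<eta> \<in> H \<Longrightarrow> ip \<eta> (c *\<^sub>C \<xi>) = cnj c * ip \<eta> \<xi>"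
  by (metis closed(3) complex_cnj_mult ip_scale_left ip_commute)

lemma ip_zero_left: "\<zeta> \<in> H \<Longrightarrow> ip 0 \<zeta> = 0"
  using ip_scale_left[of 0 \<zeta> 0] closed by simp

lemma ip_sum_left:
  "(\<And>i. i \<in> I \<Longrightarrow> f i \<in> H) \<Longrightarrow> \<zeta> \<in> H \<Longrightarrow> ip (sum f I) \<zeta> = (\<Sum>i\<in>I. ip (f i) \<zeta>)"
  by (induction I rule: infinite_finite_induct) (simp_all add: ip_zero_left ip_add_left sum_closed)

lemmas ip_simps = closed ip_add_left ip_diff_left ip_scale_left ip_add_right ip_diff_right
  ip_scale_right

lemma hnorm_nonneg: "\<xi> \<in> H \<Longrightarrow> 0 \<le> hnorm ip \<xi>"
  by (simp add: hnorm_def ip_nonneg)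

lemma hnorm_power2: "\<xi> \<in> H \<Longrightarrow> (hnorm ip \<xi>)\<^sup>2 = Re (ip \<xi> \<xi>)"
  by (simp add: hnorm_def ip_nonneg)

lemma ip_self: "\<xi> \<in> H \<Longrightarrow> ip \<xi> \<xi> = complex_of_real ((hnorm ip \<xi>)\<^sup>2)"
  using ip_commute[of \<xi> \<xi>] by (simp add: hnorm_power2 complex_eq_iff)

lemma hnorm_zero: "hnorm ip 0 = 0"
  by (simp add: hnorm_def ip_zero_left closed)

lemma hnorm_eq_zero: "\<xi> \<in> H \<Longrightarrow> hnorm ip \<xi> = 0 \<Longrightarrow> \<xi> = 0"
  using ip_definite ip_self by simp

lemma hnorm_scale: "\<xi> \<in> H \<Longrightarrow> hnorm ip (c *\<^sub>C \<xi>) = cmod c * hnorm ip \<xi>"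
proof -
  assume \<xi>: "\<xi> \<in> H"
  have "ip (c *\<^sub>C \<xi>) (c *\<^sub>C \<xi>) = complex_of_real ((cmod c)\<^sup>2 * (hnorm ip \<xi>)\<^sup>2)"
    using \<xi> by (simp add: ip_simps ip_self[OF \<xi>] complex_norm_square del: of_real_power)
  then have "(hnorm ip (c *\<^sub>C \<xi>))\<^sup>2 = (cmod c * hnorm ip \<xi>)\<^sup>2"
    using \<xi> by (simp add: hnorm_power2[of "c *\<^sub>C \<xi>"] closed power_mult_distrib del: of_real_mult of_real_power)
  then show ?thesis
    using \<xi> by (simp add: hnorm_nonneg closed)
qed

text \<open>The parallelogram law with the square norm of the difference dropped.\<close>

lemma hnorm_add_power2_le:
  assumes "\<xi> \<in> H" "\<eta> \<in> H"
  shows "(hnorm ip (\<xi> + \<eta>))\<^sup>2 \<le> 2 * (hnorm ip \<xi>)\<^sup>2 + 2 * (hnorm ip \<eta>)\<^sup>2"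
  using assms ip_nonneg[of "\<xi> - \<eta>"] by (simp add: hnorm_power2 ip_simps)

text \<open>Each further summand costs a factor 2, whence \<open>2 ^ k\<close>. The constant is
  crude, but the estimate only serves to show that a set of norms is bounded.\<close>

lemma hnorm_sum_power2_le:
  assumes "\<And>l. l < k \<Longrightarrow> f l \<in> H"
  shows "(hnorm ip (\<Sum>l<k. f l))\<^sup>2 \<le> 2 ^ k * (\<Sum>l<(k::nat). (hnorm ip (f l))\<^sup>2)"
  using assms
proof (induction k)
  case 0
  show ?case by (simp add: hnorm_zero)
next
  case (Suc k)
  have "(hnorm ip (\<Sum>l<Suc k. f l))\<^sup>2 \<le> 2 * (hnorm ip (\<Sum>l<k. f l))\<^sup>2 + 2 * (hnorm ip (f k))\<^sup>2"
    using hnorm_add_power2_le[of "sum f {..<k}" "f k"] sum_closed[of "{..<k}" f] Suc.prems by simp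
  also have "\<dots> \<le> 2 * (2 ^ k * (\<Sum>l<k. (hnorm ip (f l))\<^sup>2)) + 2 * 2 ^ k * (hnorm ip (f k))\<^sup>2"
    using Suc by (intro add_mono mult_right_mono mult_left_mono) auto
  finally show ?case by (simp add: algebra_simps)
qed

section \<open>Orthonormal pairs\<close>

definition orthonormal_pair :: "'h \<Rightarrow> 'h \<Rightarrow> bool" where
  "orthonormal_pair p q \<longleftrightarrow> p \<in> H \<and> q \<in> H \<and> ip p p = 1 \<and> ip q q = 1 \<and> ip p q = 0 \<and> ip q p = 0"

lemma orthonormal_pair_commute: "orthonormal_pair p q \<Longrightarrow> orthonormal_pair q p"
  by (auto simp: orthonormal_pair_def)

text \<open>The remainder \<open>\<eta>\<close> left after projecting \<open>\<xi>\<close> to the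
  plane of \<open>p\<close> and \<open>q\<close> has nonnegative square norm.\<close>

lemma bessel_pair:
  assumes "orthonormal_pair p q" "\<xi> \<in> H"
  shows "(cmod (ip \<xi> p))\<^sup>2 + (cmod (ip \<xi> q))\<^sup>2 \<le> (hnorm ip \<xi>)\<^sup>2"
proof -
  define \<eta> where "\<eta> = \<xi> - (ip \<xi> p *\<^sub>C p + ip \<xi> q *\<^sub>C q)"
  have pq: "p \<in> H" "q \<in> H" "ip p p = 1" "ip q q = 1" "ip p q = 0" "ip q p = 0"
    using assms(1) by (auto simp: orthonormal_pair_def)
  have \<eta>: "\<eta> \<in> H" using assms(2) pq by (simp add: \<eta>_def closed)
  have "ip \<eta> \<eta> = ip \<xi> \<xi> - ip \<xi> p * cnj (ip \<xi> p) - ip \<xi> q * cnj (ip \<xi> q)"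
    using assms(2) pq ip_commute[of \<xi> p] ip_commute[of \<xi> q]
    by (simp add: \<eta>_def ip_simps algebra_simps)
  then have "Re (ip \<eta> \<eta>) = (hnorm ip \<xi>)\<^sup>2 - (cmod (ip \<xi> p))\<^sup>2 - (cmod (ip \<xi> q))\<^sup>2"
    using assms(2) by (simp add: hnorm_power2 complex_mult_cnj cmod_power2)
  then show ?thesis using ip_nonneg[OF \<eta>] by simp
qed

lemma hnorm_orthonormal_pair:
  assumes "orthonormal_pair p q"
  shows "(hnorm ip (c *\<^sub>C p + d *\<^sub>C q))\<^sup>2 = (cmod c)\<^sup>2 + (cmod d)\<^sup>2"
proof -
  have "c *\<^sub>C p + d *\<^sub>C q \<in> H"
    using assms by (simp add: orthonormal_pair_def closed)
  then show ?thesis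
    using assms by (simp add: orthonormal_pair_def hnorm_power2 ip_simps complex_mult_cnj cmod_power2
        flip: power2_eq_square)
qed

section \<open>Norms of operator matrices\<close>

lemma operator_matrix_norm_bdd_above:
  assumes T: "\<And>i j. i < dim_row T \<Longrightarrow> j < dim_col T \<Longrightarrow> T $$ (i, j) \<in> bounded_operators H ip"
  shows "bdd_above {sqrt (\<Sum>i<dim_row T. (hnorm ip (\<Sum>j<dim_col T. (T $$ (i, j)) (\<xi> j)))\<^sup>2) | \<xi>.
          (\<forall>j<dim_col T. \<xi> j \<in> H) \<and> (\<Sum>j<dim_col T. (hnorm ip (\<xi> j))\<^sup>2) \<le> 1}"
proof -
  let ?n = "dim_row T" and ?m = "dim_col T"
  \<comment> \<open>A real supremum is an upper bound only for a set that is bounded above. The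
    bounds of the entries supply some bound; its size is irrelevant.\<close>
  have "\<forall>i j. \<exists>K. i < ?n \<longrightarrow> j < ?m \<longrightarrow> (\<forall>\<xi>\<in>H. hnorm ip ((T $$ (i, j)) \<xi>) \<le> K * hnorm ip \<xi>)"
    using T unfolding bounded_operators_def by blast
  then obtain K where K: "\<And>i j \<xi>. i < ?n \<Longrightarrow> j < ?m \<Longrightarrow> \<xi> \<in> H \<Longrightarrow>
      hnorm ip ((T $$ (i, j)) \<xi>) \<le> K i j * hnorm ip \<xi>"
    by metis
  have T_closed: "(T $$ (i, j)) \<xi> \<in> H" if "i < ?n" "j < ?m" "\<xi> \<in> H" for i j \<xi>
    using T[OF that(1,2)] that(3) unfolding bounded_operators_def by auto
  show ?thesis
  proof (rule bdd_aboveI, clarify)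
    fix \<xi> assume \<xi>: "\<forall>j<?m. \<xi> j \<in> H" and le: "(\<Sum>j<?m. (hnorm ip (\<xi> j))\<^sup>2) \<le> 1"
    have unit: "(hnorm ip (\<xi> j))\<^sup>2 \<le> 1" if "j < ?m" for j
      using member_le_sum[of j "{..<?m}" "\<lambda>j. (hnorm ip (\<xi> j))\<^sup>2"] that le by simp
    have "(hnorm ip (\<Sum>j<?m. (T $$ (i, j)) (\<xi> j)))\<^sup>2 \<le> 2 ^ ?m * (\<Sum>j<?m. (K i j)\<^sup>2)"
      if i: "i < ?n" for i
    proof -
      have "(hnorm ip ((T $$ (i, j)) (\<xi> j)))\<^sup>2 \<le> (K i j)\<^sup>2" if j: "j < ?m" for j
      proof -
        have "(hnorm ip ((T $$ (i, j)) (\<xi> j)))\<^sup>2 \<le> (K i j * hnorm ip (\<xi> j))\<^sup>2"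
          using i j \<xi> by (intro power_mono K hnorm_nonneg T_closed) auto
        also have "\<dots> \<le> (K i j)\<^sup>2 * 1"
          unfolding power_mult_distrib using unit[OF j] by (intro mult_left_mono) auto
        finally show ?thesis by simp
      qed
      then have "2 ^ ?m * (\<Sum>j<?m. (hnorm ip ((T $$ (i, j)) (\<xi> j)))\<^sup>2) \<le> 2 ^ ?m * (\<Sum>j<?m. (K i j)\<^sup>2)"
        by (intro mult_left_mono sum_mono) auto
      moreover have "(hnorm ip (\<Sum>j<?m. (T $$ (i, j)) (\<xi> j)))\<^sup>2
          \<le> 2 ^ ?m * (\<Sum>j<?m. (hnorm ip ((T $$ (i, j)) (\<xi> j)))\<^sup>2)"
        using \<xi> by (intro hnorm_sum_power2_le T_closed[OF i]) auto
      ultimately show ?thesis by (rule order_trans[rotated])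
    qed
    then show "sqrt (\<Sum>i<?n. (hnorm ip (\<Sum>j<?m. (T $$ (i, j)) (\<xi> j)))\<^sup>2)
        \<le> sqrt (\<Sum>i<?n. 2 ^ ?m * (\<Sum>j<?m. (K i j)\<^sup>2))"
      by (intro real_sqrt_le_mono sum_mono) auto
  qed
qed

lemma operator_matrix_norm_nonneg:
  assumes T: "\<And>i j. i < dim_row T \<Longrightarrow> j < dim_col T \<Longrightarrow> T $$ (i, j) \<in> bounded_operators H ip"
  shows "0 \<le> operator_matrix_norm H ip T"
  unfolding operator_matrix_norm_def
  by (rule cSup_upper2[OF _ _ operator_matrix_norm_bdd_above[OF T]])
    (auto intro!: exI[of _ "\<lambda>_. 0"] sum_nonneg simp: closed hnorm_zero)

text \<open>The supremum covers only vectors of norm at most one, so a general vector is rescaled;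
  if its norm \<open>s\<close> is zero, all components vanish and so do both sides. The squared form
  avoids roots in later sums.\<close>

lemma operator_matrix_norm_bound:
  assumes T: "\<And>i j. i < dim_row T \<Longrightarrow> j < dim_col T \<Longrightarrow> T $$ (i, j) \<in> bounded_operators H ip"
    and \<xi>: "\<And>j. j < dim_col T \<Longrightarrow> \<xi> j \<in> H"
  shows "(\<Sum>i<dim_row T. (hnorm ip (\<Sum>j<dim_col T. (T $$ (i, j)) (\<xi> j)))\<^sup>2)
    \<le> (operator_matrix_norm H ip T)\<^sup>2 * (\<Sum>j<dim_col T. (hnorm ip (\<xi> j))\<^sup>2)"
proof -
  let ?n = "dim_row T" and ?m = "dim_col T"
  define s where "s = sqrt (\<Sum>j<?m. (hnorm ip (\<xi> j))\<^sup>2)"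
  have s2: "s\<^sup>2 = (\<Sum>j<?m. (hnorm ip (\<xi> j))\<^sup>2)"
    by (simp add: s_def sum_nonneg)
  have T_scale: "(T $$ (i, j)) (c *\<^sub>C \<zeta>) = c *\<^sub>C (T $$ (i, j)) \<zeta>"
    and T_closed: "(T $$ (i, j)) \<zeta> \<in> H" if "i < ?n" "j < ?m" "\<zeta> \<in> H" for i j \<zeta> c
    using T[OF that(1,2)] that(3) unfolding bounded_operators_def by auto
  show ?thesis
  proof (cases "s = 0")
    case True
    then have "\<forall>j\<in>{..<?m}. (hnorm ip (\<xi> j))\<^sup>2 = 0"
      using s2 by (subst sum_nonneg_eq_0_iff[symmetric]) auto
    then have "\<xi> j = 0" if "j < ?m" for j
      using hnorm_eq_zero \<xi> that by auto
    moreover have "(T $$ (i, j)) 0 = 0" if "i < ?n" "j < ?m" for i j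
      using T_scale[OF that closed(1), of 0] by simp
    ultimately show ?thesis
      using s2 by (simp add: True hnorm_zero)
  next
    case False
    then have s: "s > 0" by (simp add: s_def sum_nonneg less_le)
    define \<eta> where "\<eta> j = complex_of_real (1 / s) *\<^sub>C \<xi> j" for j
    have \<eta>: "\<eta> j \<in> H" "hnorm ip (\<eta> j) = hnorm ip (\<xi> j) / s" if "j < ?m" for j
      using \<xi>[OF that] s by (simp_all add: \<eta>_def closed hnorm_scale norm_divide)
    have "(\<Sum>j<?m. (hnorm ip (\<eta> j))\<^sup>2) = (\<Sum>j<?m. (hnorm ip (\<xi> j))\<^sup>2) / s\<^sup>2"
      by (simp add: \<eta> power_divide sum_divide_distrib)
    then have "(\<Sum>j<?m. (hnorm ip (\<eta> j))\<^sup>2) \<le> 1"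
      using s by (simp flip: s2)
    then have "sqrt (\<Sum>i<?n. (hnorm ip (\<Sum>j<?m. (T $$ (i, j)) (\<eta> j)))\<^sup>2) \<le> operator_matrix_norm H ip T"
      unfolding operator_matrix_norm_def
      by (intro cSup_upper[OF _ operator_matrix_norm_bdd_above[OF T]]) (use \<eta> in auto)
    then have le: "(\<Sum>i<?n. (hnorm ip (\<Sum>j<?m. (T $$ (i, j)) (\<eta> j)))\<^sup>2) \<le> (operator_matrix_norm H ip T)\<^sup>2"
      by (rule sqrt_le_D)
    have "(\<Sum>i<?n. (hnorm ip (\<Sum>j<?m. (T $$ (i, j)) (\<eta> j)))\<^sup>2)
      = (\<Sum>i<?n. (hnorm ip (\<Sum>j<?m. (T $$ (i, j)) (\<xi> j)))\<^sup>2) / s\<^sup>2"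
      unfolding sum_divide_distrib
    proof (rule sum.cong[OF refl])
      fix i assume "i \<in> {..<?n}"
      then have i: "i < ?n" by simp
      have "(\<Sum>j<?m. (T $$ (i, j)) (\<eta> j)) = complex_of_real (1 / s) *\<^sub>C (\<Sum>j<?m. (T $$ (i, j)) (\<xi> j))"
        by (simp add: \<eta>_def T_scale[OF i] \<xi> complex_vector.scale_sum_right del: of_real_divide)
      moreover have "(\<Sum>j<?m. (T $$ (i, j)) (\<xi> j)) \<in> H"
        by (intro sum_closed T_closed[OF i] \<xi>) auto
      ultimately show "(hnorm ip (\<Sum>j<?m. (T $$ (i, j)) (\<eta> j)))\<^sup>2
          = (hnorm ip (\<Sum>j<?m. (T $$ (i, j)) (\<xi> j)))\<^sup>2 / s\<^sup>2"
        using s by (simp add: hnorm_scale norm_divide power_divide)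
    qed
    with le s show ?thesis
      by (simp add: s2[symmetric] divide_le_eq)
  qed
qed

section \<open>Scalar operators and off-diagonal entries\<close>

lemma scalar_operator:
  assumes T: "T \<in> bounded_operators H ip" and eigen: "\<And>\<xi>. \<xi> \<in> H \<Longrightarrow> \<exists>c. T \<xi> = c *\<^sub>C \<xi>"
  obtains c where "\<And>\<xi>. \<xi> \<in> H \<Longrightarrow> T \<xi> = c *\<^sub>C \<xi>"
proof (cases "\<exists>\<xi>\<in>H. \<xi> \<noteq> 0")
  case False
  then have "T \<xi> = 0 *\<^sub>C \<xi>" if "\<xi> \<in> H" for \<xi>
    using eigen[OF that] that by auto
  then show ?thesis by (rule that)
next
  case True
  then obtain \<zeta> where \<zeta>: "\<zeta> \<in> H" "\<zeta> \<noteq> 0" by blast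
  obtain c where c: "T \<zeta> = c *\<^sub>C \<zeta>" using eigen \<zeta> by blast
  have T_add: "T (\<xi> + \<eta>) = T \<xi> + T \<eta>" and T_scale: "T (d *\<^sub>C \<xi>) = d *\<^sub>C T \<xi>"
    if "\<xi> \<in> H" "\<eta> \<in> H" for \<xi> \<eta> d
    using T that unfolding bounded_operators_def by auto
  have "T \<xi> = c *\<^sub>C \<xi>" if \<xi>: "\<xi> \<in> H" for \<xi>
  proof -
    obtain d where d: "T \<xi> = d *\<^sub>C \<xi>" using eigen \<xi> by blast
    \<comment> \<open>Comparing the eigenvalues at \<open>\<xi>\<close>, \<open>\<zeta>\<close> and
      \<open>\<xi> + \<zeta>\<close> leaves two cases: all three agree, or \<open>\<xi>\<close> is a
      multiple of \<open>\<zeta>\<close> and inherits its eigenvalue.\<close>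
    obtain d' where "T (\<xi> + \<zeta>) = d' *\<^sub>C (\<xi> + \<zeta>)" 
      using eigen[OF closed(2)[OF \<xi> \<zeta>(1)]] by blast
    then have "d *\<^sub>C \<xi> + c *\<^sub>C \<zeta> = d' *\<^sub>C \<xi> + d' *\<^sub>C \<zeta>"
      using T_add \<xi> \<zeta> c d by (simp add: scaleC_add_right)
    then have eq: "(d - d') *\<^sub>C \<xi> = (d' - c) *\<^sub>C \<zeta>"
      by (simp add: complex_vector.scale_left_diff_distrib algebra_simps)
    show ?thesis
    proof (cases "d = d'")
      case True
      then have "d' = c" using eq \<zeta> by simp
      then show ?thesis using True d by simp
    next
      case False
      then have "\<xi> = ((d' - c) / (d - d')) *\<^sub>C \<zeta>"
        using arg_cong[OF eq, of "scaleC (1 / (d - d'))"] by (simp add: scaleC_scaleC scaleC_one)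
      then show ?thesis
        using T_scale[OF \<zeta>(1) \<zeta>(1)] c by (simp add: scaleC_scaleC mult.commute)
    qed
  qed
  then show ?thesis by (rule that)
qed

lemma normalize:
  assumes "\<xi> \<in> H" "\<xi> \<noteq> 0"
  obtains c where "c \<noteq> 0" "ip (c *\<^sub>C \<xi>) (c *\<^sub>C \<xi>) = 1"
proof -
  define c where "c = complex_of_real (1 / hnorm ip \<xi>)"
  have "hnorm ip \<xi> \<noteq> 0" using assms hnorm_eq_zero by blast
  then show ?thesis
    using assms by (intro that[of c]) (simp_all add: c_def ip_simps ip_self[OF assms(1)] power2_eq_square)
qed

lemma nonscalar_off_diagonal:
  assumes T: "T \<in> bounded_operators H ip" and nonscalar: "\<nexists>c. \<forall>\<xi>\<in>H. T \<xi> = c *\<^sub>C \<xi>"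
  obtains p q where "orthonormal_pair p q" "ip (T p) q \<noteq> 0"
proof -
  obtain \<xi> where \<xi>: "\<xi> \<in> H" "\<nexists>c. T \<xi> = c *\<^sub>C \<xi>"
    using scalar_operator[OF T] nonscalar by metis
  have T_scale: "T (d *\<^sub>C \<xi>) = d *\<^sub>C T \<xi>" and T_closed: "\<And>\<eta>. \<eta> \<in> H \<Longrightarrow> T \<eta> \<in> H" for d
    using T \<xi> unfolding bounded_operators_def by auto
  have "\<xi> \<noteq> 0" using \<xi>(2) T_scale[of 0] by auto
  then obtain c where c: "c \<noteq> 0" "ip (c *\<^sub>C \<xi>) (c *\<^sub>C \<xi>) = 1"
    using normalize \<xi> by blast
  define p where "p = c *\<^sub>C \<xi>"
  have p: "p \<in> H" "ip p p = 1" "T p \<in> H"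
    using c \<xi> T_closed by (simp_all add: p_def closed)
  \<comment> \<open>The component of \<open>T p\<close> orthogonal to \<open>p\<close>. It is
    nonzero since \<open>\<xi>\<close>, and with it \<open>p\<close>, is not an eigenvector;
    normalized, it is the second vector of the pair.\<close>
  define r where "r = T p - ip (T p) p *\<^sub>C p"
  have r: "r \<in> H" "ip r p = 0" "ip p r = 0"
    using p ip_commute[of "T p" p] by (simp_all add: r_def ip_simps)
  have "r \<noteq> 0"
  proof
    assume "r = 0"
    then have "c *\<^sub>C T \<xi> = c *\<^sub>C (ip (T p) p *\<^sub>C \<xi>)"
      by (simp add: r_def p_def T_scale scaleC_scaleC mult.commute)
    then have "T \<xi> = ip (T p) p *\<^sub>C \<xi>"
      by (rule complex_vector.scale_left_imp_eq[OF c(1)])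
    then show False using \<xi>(2) by blast
  qed
  then obtain d where d: "d \<noteq> 0" "ip (d *\<^sub>C r) (d *\<^sub>C r) = 1"
    using normalize r by blast
  have "ip (T p) r = ip r r"
    using p r by (simp add: r_def ip_simps)
  then have "ip (T p) (d *\<^sub>C r) \<noteq> 0"
    using d r p ip_definite[of r] \<open>r \<noteq> 0\<close> by (auto simp: ip_simps)
  moreover have "orthonormal_pair p (d *\<^sub>C r)"
    using p r d(2) by (simp add: orthonormal_pair_def ip_simps)
  ultimately show ?thesis by (rule that[rotated])
qed

end

section \<open>Matrix estimates in a concrete representation\<close>

locale represented = hilbert H ip for H :: "'h::complex_vector set" and ip +
  fixes \<phi> :: "'v::complex_vector \<Rightarrow> 'h \<Rightarrow> 'h" and nrm :: "'v mat \<Rightarrow> real"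
  assumes linear: "operator_linear H ip \<phi>"
    and norm_eq: "\<And>x. operator_matrix_norm H ip (map_mat \<phi> x) = nrm x"
begin

lemma bounded: "\<phi> x \<in> bounded_operators H ip"
  and add: "\<xi> \<in> H \<Longrightarrow> \<phi> (x + y) \<xi> = \<phi> x \<xi> + \<phi> y \<xi>"
  and scale: "\<xi> \<in> H \<Longrightarrow> \<phi> (c *\<^sub>C x) \<xi> = c *\<^sub>C \<phi> x \<xi>"
  using linear unfolding operator_linear_def by blast+

lemma in_space: "\<xi> \<in> H \<Longrightarrow> \<phi> x \<xi> \<in> H"
  and op_add: "\<xi> \<in> H \<Longrightarrow> \<eta> \<in> H \<Longrightarrow> \<phi> x (\<xi> + \<eta>) = \<phi> x \<xi> + \<phi> x \<eta>"
  and op_scale: "\<xi> \<in> H \<Longrightarrow> \<phi> x (c *\<^sub>C \<xi>) = c *\<^sub>C \<phi> x \<xi>"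
  using bounded[of x] unfolding bounded_operators_def by auto

lemma nrm_nonneg: "0 \<le> nrm x"
  using operator_matrix_norm_nonneg[of "map_mat \<phi> x"] bounded by (simp add: norm_eq)

lemma nrm_bound:
  assumes "x \<in> carrier_mat n m" "\<And>j. j < m \<Longrightarrow> \<xi> j \<in> H"
  shows "(\<Sum>i<n. (hnorm ip (\<Sum>j<m. \<phi> (x $$ (i, j)) (\<xi> j)))\<^sup>2)
    \<le> (nrm x)\<^sup>2 * (\<Sum>j<m. (hnorm ip (\<xi> j))\<^sup>2)"
  using operator_matrix_norm_bound[of "map_mat \<phi> x" \<xi>] assms bounded by (simp add: norm_eq)

text \<open>The functionals \<open>x \<mapsto> \<langle>\<phi> x p, p\<rangle>\<close> and \<open>x \<mapsto> \<langle>\<phi> x q, p\<rangle>\<close> form a completely contractive row,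
  and \<open>x \<mapsto> \<langle>\<phi> x p, p\<rangle>\<close> and \<open>x \<mapsto> \<langle>\<phi> x p, q\<rangle>\<close> a completely contractive column.\<close>

lemma row_bound:
  assumes pq: "orthonormal_pair p q" and x: "x \<in> carrier_mat n k"
  shows "(\<Sum>i<n. (cmod (\<Sum>l<k. ip (\<phi> (x $$ (i, l)) p) p * C l + ip (\<phi> (x $$ (i, l)) q) p * D l))\<^sup>2)
    \<le> (nrm x)\<^sup>2 * (\<Sum>l<k. (cmod (C l))\<^sup>2 + (cmod (D l))\<^sup>2)"
proof -
  have H: "p \<in> H" "q \<in> H" using pq by (auto simp: orthonormal_pair_def)
  \<comment> \<open>By orthonormality the square norm of this vector is
    \<open>(cmod (C l))\<^sup>2 + (cmod (D l))\<^sup>2\<close>, the summand on the right-hand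
    side.\<close>
  define \<xi> where "\<xi> l = C l *\<^sub>C p + D l *\<^sub>C q" for l
  have \<xi>: "\<xi> l \<in> H" for l using H by (simp add: \<xi>_def closed)
  have "(\<Sum>l<k. ip (\<phi> (x $$ (i, l)) p) p * C l + ip (\<phi> (x $$ (i, l)) q) p * D l)
    = ip (\<Sum>l<k. \<phi> (x $$ (i, l)) (\<xi> l)) p" for i
    using H by (simp add: ip_sum_left in_space \<xi>_def op_add op_scale closed ip_add_left
        ip_scale_left mult.commute)
  \<comment> \<open>A row has its values in the direction of \<open>p\<close> alone, so the
    \<open>q\<close> component in Bessel's inequality is dropped.\<close>
  moreover have "(cmod (ip (\<Sum>l<k. \<phi> (x $$ (i, l)) (\<xi> l)) p))\<^sup>2
    \<le> (hnorm ip (\<Sum>l<k. \<phi> (x $$ (i, l)) (\<xi> l)))\<^sup>2" for i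
    using bessel_pair[OF pq, of "\<Sum>l<k. \<phi> (x $$ (i, l)) (\<xi> l)"]
    by (smt (verit, best) \<xi> in_space sum_closed zero_le_power2)
  ultimately have "(\<Sum>i<n. (cmod (\<Sum>l<k. ip (\<phi> (x $$ (i, l)) p) p * C l + ip (\<phi> (x $$ (i, l)) q) p * D l))\<^sup>2)
      \<le> (\<Sum>i<n. (hnorm ip (\<Sum>l<k. \<phi> (x $$ (i, l)) (\<xi> l)))\<^sup>2)"
    by (simp add: sum_mono)
  also have "\<dots> \<le> (nrm x)\<^sup>2 * (\<Sum>l<k. (hnorm ip (\<xi> l))\<^sup>2)"
    using nrm_bound[OF x] \<xi> by blast
  finally show ?thesis
    by (simp add: \<xi>_def hnorm_orthonormal_pair[OF pq])
qed

lemma column_bound: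
  assumes pq: "orthonormal_pair p q" and y: "y \<in> carrier_mat k m"
  shows "(\<Sum>l<k. (cmod (\<Sum>j<m. ip (\<phi> (y $$ (l, j)) p) p * \<alpha> j))\<^sup>2 +
      (cmod (\<Sum>j<m. ip (\<phi> (y $$ (l, j)) p) q * \<alpha> j))\<^sup>2)
    \<le> (nrm y)\<^sup>2 * (\<Sum>j<m. (cmod (\<alpha> j))\<^sup>2)"
proof -
  have H: "p \<in> H" "q \<in> H" "ip p p = 1" using pq by (auto simp: orthonormal_pair_def)
  \<comment> \<open>Dual to the row: the input lies in the direction of \<open>p\<close> alone, and
    both components of the output are kept.\<close>
  define \<xi> where "\<xi> j = \<alpha> j *\<^sub>C p" for j
  have \<xi>: "\<xi> j \<in> H" for j using H by (simp add: \<xi>_def closed)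
  have "(\<Sum>j<m. ip (\<phi> (y $$ (l, j)) p) w * \<alpha> j) = ip (\<Sum>j<m. \<phi> (y $$ (l, j)) (\<xi> j)) w"
    if "w \<in> H" for l w
    using H that by (simp add: ip_sum_left in_space \<xi>_def op_scale closed ip_scale_left mult.commute)
  then have "(\<Sum>l<k. (cmod (\<Sum>j<m. ip (\<phi> (y $$ (l, j)) p) p * \<alpha> j))\<^sup>2 +
      (cmod (\<Sum>j<m. ip (\<phi> (y $$ (l, j)) p) q * \<alpha> j))\<^sup>2)
      \<le> (\<Sum>l<k. (hnorm ip (\<Sum>j<m. \<phi> (y $$ (l, j)) (\<xi> j)))\<^sup>2)"
    using H by (simp add: sum_mono bessel_pair[OF pq] sum_closed in_space \<xi>)
  also have "\<dots> \<le> (nrm y)\<^sup>2 * (\<Sum>j<m. (hnorm ip (\<xi> j))\<^sup>2)"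
    using nrm_bound[OF y] \<xi> by blast
  finally show ?thesis
    using H by (simp add: \<xi>_def hnorm_scale hnorm_def[of ip p])
qed

end

text \<open>If \<open>\<phi> a\<close> were a scalar operator, it would equal
  \<open>\<phi> (c *\<^sub>C e)\<close> for some \<open>c\<close>, and injectivity of
  \<open>\<phi>\<close> would make \<open>a\<close> a scalar.\<close>

lemma unital_operator_space_off_diagonal:
  fixes nrm :: "'v::complex_vector mat \<Rightarrow> real"
  assumes V: "unital_operator_space TYPE('h::complex_vector) nrm e" and a: "a \<notin> scalars e"
  obtains H :: "'h::complex_vector set" and ip \<phi> p q where "represented H ip \<phi> nrm" and "\<phi> e = id_operator H"
    and "hilbert.orthonormal_pair H ip p q" and "ip (\<phi> a p) q \<noteq> 0"
proof -
  obtain H :: "'h set" and ip \<phi> where H: "hilbert_space H ip" "operator_linear H ip \<phi>" "inj \<phi>"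
    "\<And>x. operator_matrix_norm H ip (map_mat \<phi> x) = nrm x" "\<phi> e = id_operator H"
    using V unfolding unital_operator_space_def by blast
  interpret represented H ip \<phi> nrm
    using H by unfold_locales auto
  have "\<nexists>c. \<forall>\<xi>\<in>H. \<phi> a \<xi> = c *\<^sub>C \<xi>"
  proof
    assume "\<exists>c. \<forall>\<xi>\<in>H. \<phi> a \<xi> = c *\<^sub>C \<xi>"
    then obtain c where c: "\<And>\<xi>. \<xi> \<in> H \<Longrightarrow> \<phi> a \<xi> = c *\<^sub>C \<xi>" by blast
    have ext: "\<phi> x \<in> H \<rightarrow>\<^sub>E H" for x
      using bounded unfolding bounded_operators_def by blast
    have "\<phi> a = \<phi> (c *\<^sub>C e)"
      by (rule PiE_ext[OF ext ext]) (simp add: c scale H(5))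
    then show False
      using a injD[OF H(3)] unfolding scalars_def by blast
  qed
  then obtain p q where "orthonormal_pair p q" "ip (\<phi> a p) q \<noteq> 0"
    using nonscalar_off_diagonal[OF bounded] by blast
  then show ?thesis
    using that represented_axioms H(5) by blast
qed


section \<open>A non-multiplicative contractive functional\<close>

text \<open>The last conclusion is complete contractivity of \<open>\<psi>\<close>, written with
  coordinate vectors \<open>\<alpha>\<close> so that it can be transferred to any one-dimensional
  Hilbert space.\<close>

lemma haagerup_functional:
  fixes nrm\<^sub>1 :: "'v1::complex_vector mat \<Rightarrow> real" and nrm\<^sub>2 :: "'v2::complex_vector mat \<Rightarrow> real"
  assumes "unital_operator_space TYPE('h1::complex_vector) nrm\<^sub>1 e\<^sub>1"
    and "unital_operator_space TYPE('h2::complex_vector) nrm\<^sub>2 e\<^sub>2"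
    and "a \<notin> scalars e\<^sub>1" and "b \<notin> scalars e\<^sub>2"
  obtains \<psi> :: "('v1, 'v2) tensor \<Rightarrow> complex"
  where "\<And>s t. \<psi> (s + t) = \<psi> s + \<psi> t" and "\<And>c t. \<psi> (c *\<^sub>C t) = c * \<psi> t"
    and "\<psi> (e\<^sub>1 \<otimes>\<^sub>C e\<^sub>2) = 1"
    and "\<psi> (a \<otimes>\<^sub>C b) \<noteq> \<psi> (a \<otimes>\<^sub>C e\<^sub>2) * \<psi> (e\<^sub>1 \<otimes>\<^sub>C b)"
    and "\<And>z \<alpha>. (\<Sum>j<dim_col z. (cmod (\<alpha> j))\<^sup>2) \<le> 1 \<Longrightarrow>
      sqrt (\<Sum>i<dim_row z. (cmod (\<Sum>j<dim_col z. \<psi> (z $$ (i, j)) * \<alpha> j))\<^sup>2)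
        \<le> haagerup_norm nrm\<^sub>1 nrm\<^sub>2 z"
proof -
  \<comment> \<open>The pair is taken in the order \<open>q1\<close>, \<open>p1\<close>: the row
    uses the entry leading from \<open>q1\<close> to \<open>p1\<close>, whereas the column uses the
    one from \<open>p2\<close> to \<open>q2\<close>.\<close>
  obtain H1 :: "'h1 set" and ip1 \<phi>1 p1 q1 where r1: "represented H1 ip1 \<phi>1 nrm\<^sub>1"
    "\<phi>1 e\<^sub>1 = id_operator H1" "hilbert.orthonormal_pair H1 ip1 q1 p1" "ip1 (\<phi>1 a q1) p1 \<noteq> 0"
    using unital_operator_space_off_diagonal[OF assms(1,3)] by metis
  obtain H2 :: "'h2 set" and ip2 \<phi>2 p2 q2 where r2: "represented H2 ip2 \<phi>2 nrm\<^sub>2"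
    "\<phi>2 e\<^sub>2 = id_operator H2" "hilbert.orthonormal_pair H2 ip2 p2 q2" "ip2 (\<phi>2 b p2) q2 \<noteq> 0"
    using unital_operator_space_off_diagonal[OF assms(2,4)] by metis
  interpret R1: represented H1 ip1 \<phi>1 nrm\<^sub>1 by (fact r1(1))
  interpret R2: represented H2 ip2 \<phi>2 nrm\<^sub>2 by (fact r2(1))
  note pq1 = R1.orthonormal_pair_commute[OF r1(3)]
  note pq2 = r2(3)
  have H1: "p1 \<in> H1" "q1 \<in> H1" "ip1 p1 p1 = 1" "ip1 q1 p1 = 0"
    using pq1 by (auto simp: R1.orthonormal_pair_def)
  have H2: "p2 \<in> H2" "q2 \<in> H2" "ip2 p2 p2 = 1" "ip2 p2 q2 = 0"
    using pq2 by (auto simp: R2.orthonormal_pair_def)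
  define r s where "r x = ip1 (\<phi>1 x p1) p1" and "s x = ip1 (\<phi>1 x q1) p1" for x
  define c d where "c y = ip2 (\<phi>2 y p2) p2" and "d y = ip2 (\<phi>2 y p2) q2" for y
  have r_s: "r (x + x') = r x + r x'" "s (x + x') = s x + s x'"
    "r (k *\<^sub>C x) = k * r x" "s (k *\<^sub>C x) = k * s x" for x x' k
    using H1 by (simp_all add: r_def s_def R1.add R1.scale R1.in_space R1.ip_simps)
  have c_d: "c (x + x') = c x + c x'" "d (x + x') = d x + d x'"
    "c (k *\<^sub>C x) = k * c x" "d (k *\<^sub>C x) = k * d x" for x x' k
    using H2 by (simp_all add: c_def d_def R2.add R2.scale R2.in_space R2.ip_simps)
  \<comment> \<open>The units act as identities, so these are diagonal and off-diagonal entries of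
    an identity matrix.\<close>
  have unit: "r e\<^sub>1 = 1" "s e\<^sub>1 = 0" "c e\<^sub>2 = 1" "d e\<^sub>2 = 0"
    using H1 H2 by (simp_all add: r_def s_def c_def d_def r1(2) r2(2))
  define B where "B x y = r x * c y + s x * d y" for x y
  have B: "B (x + x') y = B x y + B x' y" "B x (y + y') = B x y + B x y'"
    "B (k *\<^sub>C x) y = k * B x y" "B x (k *\<^sub>C y) = k * B x y" for x x' y y' k
    by (simp_all add: B_def r_s c_d algebra_simps)
  obtain \<psi> :: "('v1, 'v2) tensor \<Rightarrow> complex"
    where \<psi>: "\<And>s t. \<psi> (s + t) = \<psi> s + \<psi> t" "\<And>c t. \<psi> (c *\<^sub>C t) = c * \<psi> t"
      and \<psi>_B: "\<And>x y. \<psi> (x \<otimes>\<^sub>C y) = B x y"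
    using bilinear_lift[of B, OF B] by blast
  note \<psi>_tensor = \<psi>_B[unfolded B_def]
  have \<psi>_zero: "\<psi> 0 = 0" using \<psi>(2)[of 0 0] by simp
  have \<psi>_sum: "\<psi> (sum f I) = (\<Sum>i\<in>I. \<psi> (f i))" for f and I :: "nat set"
    by (induction I rule: infinite_finite_induct) (simp_all add: \<psi> \<psi>_zero)
  show ?thesis
  proof (rule that[OF \<psi>])
    show "\<psi> (e\<^sub>1 \<otimes>\<^sub>C e\<^sub>2) = 1"
      by (simp add: \<psi>_tensor unit)
    \<comment> \<open>The two sides differ by \<open>s a * d b\<close>, both factors of which are
      nonzero by the choice of the pairs.\<close>
    show "\<psi> (a \<otimes>\<^sub>C b) \<noteq> \<psi> (a \<otimes>\<^sub>C e\<^sub>2) * \<psi> (e\<^sub>1 \<otimes>\<^sub>C b)"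
      using r1(4) r2(4) by (simp add: \<psi>_tensor unit s_def[of a] d_def[of b])
    fix z :: "('v1, 'v2) tensor mat" and \<alpha> :: "nat \<Rightarrow> complex"
    let ?n = "dim_row z" and ?m = "dim_col z"
    assume \<alpha>: "(\<Sum>j<?m. (cmod (\<alpha> j))\<^sup>2) \<le> 1"
    show "sqrt (\<Sum>i<?n. (cmod (\<Sum>j<?m. \<psi> (z $$ (i, j)) * \<alpha> j))\<^sup>2) \<le> haagerup_norm nrm\<^sub>1 nrm\<^sub>2 z"
      unfolding haagerup_norm_def
    proof (rule cInf_greatest)
      obtain x y k where "x \<in> carrier_mat ?n k" "y \<in> carrier_mat k ?m" "z = x \<odot> y"
        by (rule matrix_tensor_factorization)
      then show "{nrm\<^sub>1 x * nrm\<^sub>2 y |x y k. x \<in> carrier_mat ?n k \<and> y \<in> carrier_mat k ?m \<and> z = x \<odot> y} \<noteq> {}"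
        by blast
    next
      fix w assume "w \<in> {nrm\<^sub>1 x * nrm\<^sub>2 y |x y k. x \<in> carrier_mat ?n k \<and> y \<in> carrier_mat k ?m \<and> z = x \<odot> y}"
      then obtain x y k where w: "w = nrm\<^sub>1 x * nrm\<^sub>2 y" and x: "x \<in> carrier_mat ?n k"
        and y: "y \<in> carrier_mat k ?m" and z: "z = x \<odot> y"
        by blast
      \<comment> \<open>The two components of the column of \<open>y\<close> applied to
        \<open>\<alpha>\<close>. Applying the row of \<open>x\<close> to them gives the matrix of
        \<open>\<psi>\<close> applied to \<open>\<alpha>\<close>, for every factorization of
        \<open>z\<close>.\<close>
      define C D where "C l = (\<Sum>j<?m. c (y $$ (l, j)) * \<alpha> j)"
        and "D l = (\<Sum>j<?m. d (y $$ (l, j)) * \<alpha> j)" for l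
      have entry: "\<psi> (z $$ (i, j)) = (\<Sum>l<k. r (x $$ (i, l)) * c (y $$ (l, j)) + s (x $$ (i, l)) * d (y $$ (l, j)))"
        if "i < ?n" "j < ?m" for i j
      proof -
        have "z $$ (i, j) = (\<Sum>l<k. x $$ (i, l) \<otimes>\<^sub>C y $$ (l, j))"
          using that x y by (subst z) (simp add: matrix_tensor_def)
        then show ?thesis by (simp add: \<psi>_sum \<psi>_tensor)
      qed
      have "(\<Sum>j<?m. \<psi> (z $$ (i, j)) * \<alpha> j) = (\<Sum>l<k. r (x $$ (i, l)) * C l + s (x $$ (i, l)) * D l)"
        if "i < ?n" for i
      proof -
        have "(\<Sum>j<?m. \<psi> (z $$ (i, j)) * \<alpha> j)
          = (\<Sum>j<?m. \<Sum>l<k. (r (x $$ (i, l)) * c (y $$ (l, j)) + s (x $$ (i, l)) * d (y $$ (l, j))) * \<alpha> j)"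
          using entry[OF that] by (simp add: sum_distrib_right)
        also have "\<dots> = (\<Sum>l<k. \<Sum>j<?m. (r (x $$ (i, l)) * c (y $$ (l, j)) + s (x $$ (i, l)) * d (y $$ (l, j))) * \<alpha> j)"
          by (rule sum.swap)
        finally show ?thesis
          by (simp add: C_def D_def sum_distrib_left sum.distrib algebra_simps)
      qed
      then have "(\<Sum>i<?n. (cmod (\<Sum>j<?m. \<psi> (z $$ (i, j)) * \<alpha> j))\<^sup>2)
        = (\<Sum>i<?n. (cmod (\<Sum>l<k. r (x $$ (i, l)) * C l + s (x $$ (i, l)) * D l))\<^sup>2)"
        by simp
      also have "\<dots> \<le> (nrm\<^sub>1 x)\<^sup>2 * (\<Sum>l<k. (cmod (C l))\<^sup>2 + (cmod (D l))\<^sup>2)"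
        unfolding r_def s_def by (rule R1.row_bound[OF pq1 x])
      also have "\<dots> \<le> (nrm\<^sub>1 x)\<^sup>2 * ((nrm\<^sub>2 y)\<^sup>2 * (\<Sum>j<?m. (cmod (\<alpha> j))\<^sup>2))"
        unfolding C_def D_def c_def d_def by (intro mult_left_mono R2.column_bound[OF pq2 y]) simp
      also have "\<dots> \<le> (nrm\<^sub>1 x)\<^sup>2 * ((nrm\<^sub>2 y)\<^sup>2 * 1)"
        using \<alpha> by (intro mult_left_mono) auto
      finally show "sqrt (\<Sum>i<?n. (cmod (\<Sum>j<?m. \<psi> (z $$ (i, j)) * \<alpha> j))\<^sup>2) \<le> w"
        unfolding w by (intro real_le_lsqrt mult_nonneg_nonneg R1.nrm_nonneg R2.nrm_nonneg)
          (simp add: power_mult_distrib)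
    qed
  qed
qed


section \<open>One-dimensional representations\<close>

text \<open>Hilbert spaces are subspaces of the ambient space here, so the complex numbers are
  represented by the multiples of a nonzero vector, with \<open>coord\<close> as the isometric
  identification.\<close>

locale complex_line =
  fixes u :: "'h::complex_vector"
  assumes u_nonzero: "u \<noteq> 0"
begin

definition line :: "'h set" where "line = range (\<lambda>c. c *\<^sub>C u)"

definition coord :: "'h \<Rightarrow> complex" where "coord \<xi> = (THE c. \<xi> = c *\<^sub>C u)"

definition line_ip :: "'h \<Rightarrow> 'h \<Rightarrow> complex" where "line_ip \<xi> \<eta> = coord \<xi> * cnj (coord \<eta>)"

lemma coord_scale [simp]: "coord (c *\<^sub>C u) = c"
  unfolding coord_def by (rule the_equality) (use u_nonzero in auto)

lemma line_scale [simp]: "c *\<^sub>C u \<in> line"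
  unfolding line_def by (rule rangeI)

lemma line_coord: "\<xi> \<in> line \<Longrightarrow> coord \<xi> *\<^sub>C u = \<xi>"
  by (auto simp: line_def)

lemma subspace_line: "complex_vector.subspace line"
proof (rule complex_vector.subspaceI)
  show "0 \<in> line"
    using line_scale[of 0] by simp
  show "\<xi> + \<eta> \<in> line" if "\<xi> \<in> line" "\<eta> \<in> line" for \<xi> \<eta>
    by (metis line_coord line_scale scaleC_add_left that)
  show "c *\<^sub>C \<xi> \<in> line" if "\<xi> \<in> line" for c \<xi>
    by (metis line_coord line_scale scaleC_scaleC that)
qed

lemma coord_add: "\<xi> \<in> line \<Longrightarrow> \<eta> \<in> line \<Longrightarrow> coord (\<xi> + \<eta>) = coord \<xi> + coord \<eta>"
  by (auto simp: line_def simp flip: scaleC_add_left)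

lemma coord_diff: "\<xi> \<in> line \<Longrightarrow> \<eta> \<in> line \<Longrightarrow> coord (\<xi> - \<eta>) = coord \<xi> - coord \<eta>"
  by (auto simp: line_def simp flip: complex_vector.scale_left_diff_distrib)

lemma coord_scaleC: "\<xi> \<in> line \<Longrightarrow> coord (c *\<^sub>C \<xi>) = c * coord \<xi>"
  by (auto simp: line_def scaleC_scaleC)

lemma coord_sum: "(\<And>i. i \<in> I \<Longrightarrow> f i \<in> line) \<Longrightarrow> coord (sum f I) = (\<Sum>i\<in>I. coord (f i))"
proof (induction I rule: infinite_finite_induct)
  case (insert i I)
  then show ?case
    by (simp add: coord_add complex_vector.subspace_sum[OF subspace_line])
qed (use coord_scale[of 0] in simp_all)

lemma hnorm_line [simp]: "hnorm line_ip \<xi> = cmod (coord \<xi>)"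
  by (simp add: hnorm_def line_ip_def complex_mult_cnj cmod_def)

lemma hilbert_line: "hilbert_space line line_ip"
  unfolding hilbert_space_def
proof (intro conjI ballI allI impI)
  show "complex_vector.subspace line" by (rule subspace_line)
next
  fix X :: "nat \<Rightarrow> 'h"
  assume X: "(\<forall>n. X n \<in> line) \<and>
    (\<forall>\<epsilon>>0. \<exists>M. \<forall>m\<ge>M. \<forall>n\<ge>M. hnorm line_ip (X m - X n) < \<epsilon>)"
  then have X_line: "X n \<in> line" for n by blast
  \<comment> \<open>Completeness is inherited from the complex numbers, since \<open>coord\<close>
    preserves norms and differences on the line.\<close>
  have "Cauchy (\<lambda>n. coord (X n))"
    using X unfolding Cauchy_def by (simp add: coord_diff[OF X_line X_line] dist_norm)
  then obtain c where c: "(\<lambda>n. coord (X n)) \<longlonglongrightarrow> c"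
    by (auto simp: Cauchy_convergent_iff convergent_def)
  have "(\<lambda>n. hnorm line_ip (X n - c *\<^sub>C u)) \<longlonglongrightarrow> 0"
    using c by (simp add: coord_diff[OF X_line] LIM_zero tendsto_norm_zero)
  then show "\<exists>\<xi>\<in>line. (\<lambda>n. hnorm line_ip (X n - \<xi>)) \<longlonglongrightarrow> 0"
    using line_scale by blast
next
  fix \<xi> assume \<xi>: "\<xi> \<in> line" "line_ip \<xi> \<xi> = 0"
  then have "coord \<xi> = 0" by (simp add: line_ip_def)
  then show "\<xi> = 0" using line_coord[OF \<xi>(1)] by simp
qed (simp_all add: line_ip_def coord_add coord_scaleC algebra_simps)

text \<open>Under \<open>coord\<close>, the operator matrix becomes the scalar matrix with entries
  \<open>\<psi> (z $$ (i, j))\<close> acting on coordinate vectors, so \<open>contractive\<close>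
  bounds each member of the set whose supremum is the norm.\<close>

lemma ucc_line:
  fixes nrm :: "'v::complex_vector mat \<Rightarrow> real"
  assumes \<psi>: "\<And>s t. \<psi> (s + t) = \<psi> s + \<psi> t" "\<And>c t. \<psi> (c *\<^sub>C t) = c * \<psi> t" "\<psi> e = 1"
    and contractive: "\<And>n z \<alpha>. z \<in> carrier_mat n n \<Longrightarrow> (\<Sum>j<n. (cmod (\<alpha> j))\<^sup>2) \<le> 1 \<Longrightarrow>
      sqrt (\<Sum>i<n. (cmod (\<Sum>j<n. \<psi> (z $$ (i, j)) * \<alpha> j))\<^sup>2) \<le> nrm z"
  shows "ucc nrm e line line_ip (\<lambda>v. \<lambda>\<xi>\<in>line. \<psi> v *\<^sub>C \<xi>)"
  unfolding ucc_def
proof (intro conjI allI ballI)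
  have "\<exists>K. \<forall>\<xi>\<in>line. cmod (coord (\<psi> x *\<^sub>C \<xi>)) \<le> K * cmod (coord \<xi>)" for x
    by (rule exI[of _ "cmod (\<psi> x)"]) (simp add: coord_scaleC norm_mult)
  then show "operator_linear line line_ip (\<lambda>v. \<lambda>\<xi>\<in>line. \<psi> v *\<^sub>C \<xi>)"
    using complex_vector.subspace_add[OF subspace_line] complex_vector.subspace_scale[OF subspace_line]
    by (auto simp: operator_linear_def bounded_operators_def \<psi> scaleC_add_left scaleC_add_right
        scaleC_scaleC mult.commute)
  show "(\<lambda>\<xi>\<in>line. \<psi> e *\<^sub>C \<xi>) = id_operator line"
    by (auto simp: \<psi> scaleC_one)
  fix n and z :: "'v mat"
  assume z: "z \<in> carrier_mat n n"
  show "operator_matrix_norm line line_ip (map_mat (\<lambda>v. \<lambda>\<xi>\<in>line. \<psi> v *\<^sub>C \<xi>) z) \<le> nrm z"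
    unfolding operator_matrix_norm_def
  proof (rule cSup_least, goal_cases)
    case 1
    \<comment> \<open>The zero family shows that the supremum is over a nonempty set.\<close>
    have "0 \<in> line" using line_scale[of 0] by simp
    moreover have "coord 0 = 0" using coord_scale[of 0] by simp
    ultimately show ?case by (auto intro!: exI[of _ "\<lambda>_. 0"])
  next
    case (2 w)
    then obtain \<xi> where \<xi>: "\<forall>j<n. \<xi> j \<in> line" "(\<Sum>j<n. (cmod (coord (\<xi> j)))\<^sup>2) \<le> 1"
      and w: "w = sqrt (\<Sum>i<n. (cmod (coord (\<Sum>j<n. \<psi> (z $$ (i, j)) *\<^sub>C \<xi> j)))\<^sup>2)"
      using z by (force simp del: real_sqrt_eq_iff)
    have "coord (\<Sum>j<n. \<psi> (z $$ (i, j)) *\<^sub>C \<xi> j) = (\<Sum>j<n. \<psi> (z $$ (i, j)) * coord (\<xi> j))" for i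
      using \<xi>(1)
      by (subst coord_sum) (auto simp: coord_scaleC complex_vector.subspace_scale[OF subspace_line])
    then show ?case
      using contractive[OF z \<xi>(2)] by (simp add: w)
  qed
qed

end


section \<open>The universal C*-cover of the Haagerup tensor product\<close>

text \<open>An independent set does not contain zero. The vector found spans the line that carries
  the representation.\<close>

lemma ample_nonzero:
  assumes "ample TYPE('h::complex_vector) TYPE('v)"
  obtains u :: "'h::complex_vector" where "u \<noteq> 0"
proof -
  obtain f :: "('v \<Rightarrow> complex) \<Rightarrow> 'h" where "complex_vector.independent (range f)"
    using assms unfolding ample_def by blast
  then have "f (\<lambda>_. 0) \<noteq> 0"
    using complex_vector.dependent_zero by (metis rangeI)
  then show ?thesis by (rule that)
qed

lemma universal_cstar_cover_not_multiplicative: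
  fixes nrm\<^sub>1 :: "'v1::complex_vector mat \<Rightarrow> real" and e\<^sub>1 :: 'v1
    and nrm\<^sub>2 :: "'v2::complex_vector mat \<Rightarrow> real" and e\<^sub>2 :: 'v2
    and i :: "('v1, 'v2) tensor \<Rightarrow> 'a::cstar_algebra"
    and u :: "'h::complex_vector"
  assumes V: "unital_operator_space TYPE('h1::complex_vector) nrm\<^sub>1 e\<^sub>1"
      "unital_operator_space TYPE('h2::complex_vector) nrm\<^sub>2 e\<^sub>2"
    and u: "u \<noteq> 0"
    and cover: "universal_cstar_cover TYPE('h) (haagerup_norm nrm\<^sub>1 nrm\<^sub>2) (e\<^sub>1 \<otimes>\<^sub>C e\<^sub>2) i"
    and ab: "a \<notin> scalars e\<^sub>1" "b \<notin> scalars e\<^sub>2"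
  shows "i (a \<otimes>\<^sub>C b) \<noteq> i (a \<otimes>\<^sub>C e\<^sub>2) * i (e\<^sub>1 \<otimes>\<^sub>C b)"
proof
  assume eq: "i (a \<otimes>\<^sub>C b) = i (a \<otimes>\<^sub>C e\<^sub>2) * i (e\<^sub>1 \<otimes>\<^sub>C b)"
  interpret complex_line u by unfold_locales (rule u)
  obtain \<psi> :: "('v1, 'v2) tensor \<Rightarrow> complex"
    where \<psi>: "\<And>s t. \<psi> (s + t) = \<psi> s + \<psi> t" "\<And>c t. \<psi> (c *\<^sub>C t) = c * \<psi> t"
      "\<psi> (e\<^sub>1 \<otimes>\<^sub>C e\<^sub>2) = 1"
      and neq: "\<psi> (a \<otimes>\<^sub>C b) \<noteq> \<psi> (a \<otimes>\<^sub>C e\<^sub>2) * \<psi> (e\<^sub>1 \<otimes>\<^sub>C b)"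
      and bound: "\<And>z \<alpha>. (\<Sum>j<dim_col z. (cmod (\<alpha> j))\<^sup>2) \<le> 1 \<Longrightarrow>
        sqrt (\<Sum>i<dim_row z. (cmod (\<Sum>j<dim_col z. \<psi> (z $$ (i, j)) * \<alpha> j))\<^sup>2)
          \<le> haagerup_norm nrm\<^sub>1 nrm\<^sub>2 z"
    by (rule haagerup_functional[OF V ab]) (rule that; (assumption | blast))
  have "ucc (haagerup_norm nrm\<^sub>1 nrm\<^sub>2) (e\<^sub>1 \<otimes>\<^sub>C e\<^sub>2) line line_ip (\<lambda>v. \<lambda>\<xi>\<in>line. \<psi> v *\<^sub>C \<xi>)"
  proof (rule ucc_line[OF \<psi>])
    fix n and z :: "('v1, 'v2) tensor mat" and \<alpha> :: "nat \<Rightarrow> complex"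
    assume "z \<in> carrier_mat n n" "(\<Sum>j<n. (cmod (\<alpha> j))\<^sup>2) \<le> 1"
    then show "sqrt (\<Sum>i<n. (cmod (\<Sum>j<n. \<psi> (z $$ (i, j)) * \<alpha> j))\<^sup>2) \<le> haagerup_norm nrm\<^sub>1 nrm\<^sub>2 z"
      using bound[where z = z and \<alpha> = \<alpha>] by simp
  qed
  then obtain \<pi> where \<pi>: "star_rep line line_ip \<pi>" "\<And>v. \<pi> (i v) = (\<lambda>\<xi>\<in>line. \<psi> v *\<^sub>C \<xi>)"
    using cover hilbert_line unfolding universal_cstar_cover_def by blast
  have u_line: "u \<in> line"
    using line_scale[of 1] by (simp only: scaleC_one)
  \<comment> \<open>Evaluation at \<open>u\<close> turns the assumed identity into one between
    scalars, because \<open>\<pi>\<close> is multiplicative and \<open>\<pi> (i v)\<close>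
    multiplies by \<open>\<psi> v\<close>.\<close>
  have "\<pi> (i (a \<otimes>\<^sub>C b)) u = \<pi> (i (a \<otimes>\<^sub>C e\<^sub>2)) (\<pi> (i (e\<^sub>1 \<otimes>\<^sub>C b)) u)"
    using \<pi>(1) u_line unfolding eq star_rep_def by simp
  then have "\<psi> (a \<otimes>\<^sub>C b) *\<^sub>C u = (\<psi> (a \<otimes>\<^sub>C e\<^sub>2) * \<psi> (e\<^sub>1 \<otimes>\<^sub>C b)) *\<^sub>C u"
    using u_line by (simp add: \<pi>(2) scaleC_scaleC)
  then show False
    using neq u by simp
qed

theorem proposition3p5:
  fixes nrm\<^sub>1 :: "'v1::complex_vector mat \<Rightarrow> real" and e\<^sub>1 :: 'v1
    and nrm\<^sub>2 :: "'v2::complex_vector mat \<Rightarrow> real" and e\<^sub>2 :: 'v2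
    and i :: "('v1, 'v2) tensor \<Rightarrow> 'a::cstar_algebra"
  assumes "unital_operator_space TYPE('h1::complex_vector) nrm\<^sub>1 e\<^sub>1"
    and "unital_operator_space TYPE('h2::complex_vector) nrm\<^sub>2 e\<^sub>2"
    and "scalars e\<^sub>1 \<noteq> UNIV" and "scalars e\<^sub>2 \<noteq> UNIV"
    and "ample TYPE('h::complex_vector) TYPE(('v1, 'v2) tensor)"
    and "universal_cstar_cover TYPE('h) (haagerup_norm nrm\<^sub>1 nrm\<^sub>2) (e\<^sub>1 \<otimes>\<^sub>C e\<^sub>2) i"
  shows "(\<forall>a b. a \<notin> scalars e\<^sub>1 \<and> b \<notin> scalars e\<^sub>2 \<longrightarrow>
            i (a \<otimes>\<^sub>C b) \<noteq> i (a \<otimes>\<^sub>C e\<^sub>2) * i (e\<^sub>1 \<otimes>\<^sub>C b)) \<and>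
    (\<forall>(j\<^sub>1 :: 'v1 \<Rightarrow> 'a1::cstar_algebra) (j\<^sub>2 :: 'v2 \<Rightarrow> 'a2::cstar_algebra)
        (\<iota>\<^sub>1 :: 'a1 \<Rightarrow> 'f::cstar_algebra) (\<iota>\<^sub>2 :: 'a2 \<Rightarrow> 'f) (\<rho> :: 'a \<Rightarrow> 'f).
       universal_cstar_cover TYPE('h) nrm\<^sub>1 e\<^sub>1 j\<^sub>1 \<and>
       universal_cstar_cover TYPE('h) nrm\<^sub>2 e\<^sub>2 j\<^sub>2 \<and>
       unital_free_product TYPE('h) \<iota>\<^sub>1 \<iota>\<^sub>2 \<and>
       star_hom \<rho> \<and> (\<forall>x y. \<rho> (i (x \<otimes>\<^sub>C y)) = \<iota>\<^sub>1 (j\<^sub>1 x) * \<iota>\<^sub>2 (j\<^sub>2 y)) \<longrightarrow>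
       \<not> star_isomorphism \<rho>)"
proof (intro conjI allI impI)
  obtain u :: 'h where u: "u \<noteq> 0"
    using ample_nonzero[OF assms(5)] by blast
  note not_multiplicative = universal_cstar_cover_not_multiplicative[OF assms(1,2) u assms(6)]
  show "i (a \<otimes>\<^sub>C b) \<noteq> i (a \<otimes>\<^sub>C e\<^sub>2) * i (e\<^sub>1 \<otimes>\<^sub>C b)"
    if "a \<notin> scalars e\<^sub>1 \<and> b \<notin> scalars e\<^sub>2" for a b
    using not_multiplicative that by blast
  fix j\<^sub>1 :: "'v1 \<Rightarrow> 'a1::cstar_algebra" and j\<^sub>2 :: "'v2 \<Rightarrow> 'a2::cstar_algebra"
    and \<iota>\<^sub>1 :: "'a1 \<Rightarrow> 'f::cstar_algebra" and \<iota>\<^sub>2 :: "'a2 \<Rightarrow> 'f" and \<rho> :: "'a \<Rightarrow> 'f"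
  assume *: "universal_cstar_cover TYPE('h) nrm\<^sub>1 e\<^sub>1 j\<^sub>1 \<and>
       universal_cstar_cover TYPE('h) nrm\<^sub>2 e\<^sub>2 j\<^sub>2 \<and>
       unital_free_product TYPE('h) \<iota>\<^sub>1 \<iota>\<^sub>2 \<and>
       star_hom \<rho> \<and> (\<forall>x y. \<rho> (i (x \<otimes>\<^sub>C y)) = \<iota>\<^sub>1 (j\<^sub>1 x) * \<iota>\<^sub>2 (j\<^sub>2 y))"
  \<comment> \<open>Hence \<open>\<rho>\<close> maps
    \<open>i (a \<otimes>\<^sub>C e\<^sub>2)\<close> to \<open>\<iota>\<^sub>1 (j\<^sub>1 a)\<close>
    and \<open>i (e\<^sub>1 \<otimes>\<^sub>C b)\<close> to
    \<open>\<iota>\<^sub>2 (j\<^sub>2 b)\<close>.\<close>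
  then have unit: "\<iota>\<^sub>1 (j\<^sub>1 e\<^sub>1) = 1" "\<iota>\<^sub>2 (j\<^sub>2 e\<^sub>2) = 1"
    by (simp_all add: universal_cstar_cover_def cstar_cover_def unital_free_product_def)
  obtain a b where ab: "a \<notin> scalars e\<^sub>1" "b \<notin> scalars e\<^sub>2"
    using assms(3,4) by blast
  \<comment> \<open>Two distinct elements have the same image, so \<open>\<rho>\<close> is not
    injective.\<close>
  have "\<rho> (i (a \<otimes>\<^sub>C e\<^sub>2) * i (e\<^sub>1 \<otimes>\<^sub>C b)) = \<rho> (i (a \<otimes>\<^sub>C b))"
    using * by (simp add: star_hom_def unit)
  then show "\<not> star_isomorphism \<rho>"
    using not_multiplicative[OF ab] unfolding star_isomorphism_def bij_def inj_def by metis
qed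

end
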